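(* For a vector of positive weights $w=(w_1,\dots,w_N)$ let $V_1(w)=\min_{\pi\in\Pi_{\mathrm{stat}}}\max_{j\in C_0}w_jV(j;\pi)$ denote the maximal drift rate obtained from the hierarchical minimax decomposition with weights $w$. If $V_1(w)<0$ for some positive weights $w$ then $V_1(w')<0$ for all positive weights $w'$. Thus if the queue length process $X$ is stable (positive recurrent) under any JLW policy (i.e. under JLW with some positive weights), it is stable under all such policies (i.e. under JLW with any positive weights).
   Context: Model. $C_0=\{1,\dots,N\}$ is a finite set of stations; station $j$ has service rate $\mu_j>0$. There is a finite collection of non-empty sets (neighbourhoods) $S_i\subseteq C_0$ with arrival rates $\lambda_i\ge 0$; $\mathcal{N}(C_0)$ denotes the collection of neighbourhoods with $\lambda_i>0$, and one writes $i\in\mathcal{N}(C_0)$ for $S_i\in\mathcal{N}(C_0)$. The bipartite graph with nodes $\mathcal{N}(C_0)\cup C_0$ and edges $\{(S_i,j):j\in S_i\}$ is assumed connected. Policies. A stationary Markov routing policy $\pi$ assigns to each state $x\in\mathbb{Z}^N$ and each $i\in\mathcal{N}(C_0)$ a probability vector $\pi(x,i)=(\pi(x,i)_j)_{j\in C_0}$ with $\pi(x,i)_j=0$ for $j\notin S_i$. It is static if it does not depend on $x$, and then one writes $\pi(i)$; $\Pi_{\mathrm{stat}}$ is the set of static policies. For $\pi\in\Pi_{\mathrm{stat}}$, $V(j;\pi)=\sum_{i\in\mathcal{N}(C_0)}\lambda_i\pi(i)_j-\mu_j$. The JLW (join the least weighted queue) policy with positive weights $w$ is: $\pi(x,i)_j=1/|\mathcal{B}_i(x)|$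 if $j\in\mathcal{B}_i(x)$ and $0$ otherwise, where $\mathcal{B}_i(x)=\{j\in S_i: w_jx_j=\min_{l\in S_i}w_lx_l\}$. Queue length process. Under policy $\pi$, $X(t)$ is the continuous-time Markov chain on $\mathbb{N}^N$ ($\mathbb{N}=\{0,1,2,\dots\}$) with jumps $x\mapsto x+e_j$ at rate $\sum_{i\in\mathcal{N}(C_0):\,j\in S_i}\lambda_i\pi(x,i)_j$ and $x\mapsto x-e_j$ at rate $\mu_j$ when $x_j\ge1$, where $e_j$ is the $j$-th unit vector. *)

theory Defs
  imports "HOL-Probability.Probability"
begin

subsection \<open>Network, routing policies and drift rates\<close>

text \<open>Stations form the finite type \<open>'n\<close>; neighbourhoods are the sets \<open>S i\<close>, \<open>i \<in> I\<close>, with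
  arrival rates \<open>lam i\<close>; station \<open>j\<close> has service rate \<open>mu j\<close>.\<close>

definition active :: "'i set \<Rightarrow> ('i \<Rightarrow> real) \<Rightarrow> 'i set" where
  "active I lam = {i \<in> I. 0 < lam i}"

definition nodes :: "'i set \<Rightarrow> ('i \<Rightarrow> real) \<Rightarrow> ('i + 'n) set" where
  "nodes I lam = Inl ` active I lam \<union> range Inr"

definition edges :: "'i set \<Rightarrow> ('i \<Rightarrow> 'n set) \<Rightarrow> ('i \<Rightarrow> real) \<Rightarrow> (('i + 'n) \<times> ('i + 'n)) set" where
  "edges I S lam = {(Inl i, Inr j) | i j. i \<in> active I lam \<and> j \<in> S i}"

definition network_connected :: "'i set \<Rightarrow> ('i \<Rightarrow> 'n set) \<Rightarrow> ('i \<Rightarrow> real) \<Rightarrow> bool" where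
  "network_connected I S lam \<longleftrightarrow>
     (\<forall>u \<in> nodes I lam. \<forall>v \<in> nodes I lam. (u, v) \<in> (edges I S lam \<union> (edges I S lam)\<inverse>)\<^sup>*)"

type_synonym ('i, 'n) policy = "('n \<Rightarrow> int) \<Rightarrow> 'i \<Rightarrow> 'n \<Rightarrow> real"

definition is_policy ::
    "'i set \<Rightarrow> ('i \<Rightarrow> 'n::finite set) \<Rightarrow> ('i \<Rightarrow> real) \<Rightarrow> ('i, 'n) policy \<Rightarrow> bool" where
  "is_policy I S lam \<pi> \<longleftrightarrow>
     (\<forall>x. \<forall>i \<in> active I lam.
        (\<forall>j. 0 \<le> \<pi> x i j) \<and> (\<Sum>j\<in>UNIV. \<pi> x i j) = 1 \<and> (\<forall>j. j \<notin> S i \<longrightarrow> \<pi> x i j = 0))"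

definition static_policies ::
    "'i set \<Rightarrow> ('i \<Rightarrow> 'n::finite set) \<Rightarrow> ('i \<Rightarrow> real) \<Rightarrow> ('i \<Rightarrow> 'n \<Rightarrow> real) set" where
  "static_policies I S lam = {p. is_policy I S lam (\<lambda>x. p)}"

definition drift ::
    "'i set \<Rightarrow> ('i \<Rightarrow> real) \<Rightarrow> ('n \<Rightarrow> real) \<Rightarrow> ('i \<Rightarrow> 'n \<Rightarrow> real) \<Rightarrow> 'n \<Rightarrow> real" where
  "drift I lam mu p j = (\<Sum>i\<in>active I lam. lam i * p i j) - mu j"

definition max_drift ::
    "'i set \<Rightarrow> ('i \<Rightarrow> real) \<Rightarrow> ('n::finite \<Rightarrow> real) \<Rightarrow> ('n \<Rightarrow> real) \<Rightarrow> ('i \<Rightarrow> 'n \<Rightarrow> real) \<Rightarrow> real" where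
  "max_drift I lam mu w p = (MAX j\<in>UNIV. w j * drift I lam mu p j)"

text \<open>The infimum is a minimum; see \<open>V1_attained\<close> below.\<close>

definition V1 ::
    "'i set \<Rightarrow> ('i \<Rightarrow> 'n::finite set) \<Rightarrow> ('i \<Rightarrow> real) \<Rightarrow> ('n \<Rightarrow> real) \<Rightarrow> ('n \<Rightarrow> real) \<Rightarrow> real" where
  "V1 I S lam mu w = (INF p\<in>static_policies I S lam. max_drift I lam mu w p)"

definition jlw_argmin :: "('i \<Rightarrow> 'n::finite set) \<Rightarrow> ('n \<Rightarrow> real) \<Rightarrow> ('n \<Rightarrow> int) \<Rightarrow> 'i \<Rightarrow> 'n set" where
  "jlw_argmin S w x i =
     {j \<in> S i. w j * real_of_int (x j) = (MIN l\<in>S i. w l * real_of_int (x l))}"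

definition jlw :: "('i \<Rightarrow> 'n::finite set) \<Rightarrow> ('n \<Rightarrow> real) \<Rightarrow> ('i, 'n) policy" where
  "jlw S w x i j = (if j \<in> jlw_argmin S w x i then 1 / real (card (jlw_argmin S w x i)) else 0)"

definition arrival_rate ::
    "'i set \<Rightarrow> ('i \<Rightarrow> 'n set) \<Rightarrow> ('i \<Rightarrow> real) \<Rightarrow> ('i, 'n) policy \<Rightarrow> ('n \<Rightarrow> nat) \<Rightarrow> 'n \<Rightarrow> real" where
  "arrival_rate I S lam \<pi> x j =
     (\<Sum>i\<in>{i \<in> active I lam. j \<in> S i}. lam i * \<pi> (\<lambda>k. int (x k)) i j)"

definition queue_rate ::
    "'i set \<Rightarrow> ('i \<Rightarrow> 'n::finite set) \<Rightarrow> ('i \<Rightarrow> real) \<Rightarrow> ('n \<Rightarrow> real) \<Rightarrow> ('i, 'n) policy \<Rightarrow>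
     ('n \<Rightarrow> nat) \<Rightarrow> ('n \<Rightarrow> nat) \<Rightarrow> real" where
  "queue_rate I S lam mu \<pi> x y =
     (\<Sum>j\<in>{j. y = x(j := x j + 1)}. arrival_rate I S lam \<pi> x j) +
     (\<Sum>j\<in>{j. 1 \<le> x j \<and> y = x(j := x j - 1)}. mu j)"


subsection \<open>Continuous-time Markov chains\<close>

text \<open>Paths are functions on the reals of which only the values at times \<open>t \<ge> 0\<close> matter. Jump
  times are extended nonnegative reals: \<open>jump_time p n = \<top>\<close> if there are fewer than \<open>n\<close> jumps, and
  then \<open>jump_chain p n\<close> is meaningless.\<close>

fun jump_time :: "(real \<Rightarrow> 's) \<Rightarrow> nat \<Rightarrow> ennreal" where
  "jump_time p 0 = 0"
| "jump_time p (Suc n) =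
     (INF t \<in> {t. 0 \<le> t \<and> jump_time p n \<le> ennreal t \<and> p t \<noteq> p (enn2real (jump_time p n))}.
        ennreal t)"

definition jump_chain :: "(real \<Rightarrow> 's) \<Rightarrow> nat \<Rightarrow> 's" where
  "jump_chain p n = p (enn2real (jump_time p n))"

definition return_time :: "(real \<Rightarrow> 's) \<Rightarrow> 's \<Rightarrow> ennreal" where
  "return_time p x = (INF t \<in> {t. 0 \<le> t \<and> jump_time p 1 \<le> ennreal t \<and> p t = x}. ennreal t)"

definition exit_rate :: "('s \<Rightarrow> 's \<Rightarrow> real) \<Rightarrow> 's \<Rightarrow> real" where
  "exit_rate q x = (\<Sum>\<^sub>\<infinity>y\<in>-{x}. q x y)"

text \<open>\<open>X\<close> is, under \<open>M\<close>, a Markov chain started at \<open>x\<close> with jump rates \<open>q y z\<close> for \<open>y \<noteq> z\<close>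
  (where \<open>q y y = 0\<close>): a non-explosive right-continuous jump process whose jump chain is a Markov
  chain from \<open>x\<close> with transition probabilities \<open>q y z / exit_rate q y\<close>, and whose successive holding
  times are, given the jump chain, independent and exponential with rates \<open>exit_rate q (y k)\<close>. The
  last clause is the resulting joint law of the jump chain and the holding times. At an absorbing
  \<open>y n\<close> it reads correctly thanks to \<open>a / 0 = 0\<close>: the holding time is almost surely infinite, and
  trajectories that jump out of \<open>y n\<close> have probability zero. Measurability of the jump times and of
  the jump chain follows from that of \<open>X\<close> up to null sets and is listed for convenience.\<close>

definition markov_chain_from ::
    "('s::countable \<Rightarrow> 's \<Rightarrow> real) \<Rightarrow> 's \<Rightarrow> 'a measure \<Rightarrow> (real \<Rightarrow> 'a \<Rightarrow> 's) \<Rightarrow> bool" where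
  "markov_chain_from q x M X \<longleftrightarrow>
     prob_space M \<and>
     (\<forall>t\<ge>0. X t \<in> measurable M (count_space UNIV)) \<and>
     (\<forall>n. (\<lambda>\<omega>. jump_time (\<lambda>t. X t \<omega>) n) \<in> borel_measurable M) \<and>
     (\<forall>n. (\<lambda>\<omega>. jump_chain (\<lambda>t. X t \<omega>) n) \<in> measurable M (count_space UNIV)) \<and>
     (AE \<omega> in M. \<forall>t\<ge>0. \<exists>e>0. \<forall>s\<in>{t..<t + e}. X s \<omega> = X t \<omega>) \<and>
     (AE \<omega> in M. (SUP n. jump_time (\<lambda>t. X t \<omega>) n) = \<top>) \<and>
     (\<forall>n y s. (\<forall>k. 0 \<le> s k) \<longrightarrow>
        measure M {\<omega> \<in> space M. jump_time (\<lambda>t. X t \<omega>) n < \<top> \<and>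
            (\<forall>k\<le>n. jump_chain (\<lambda>t. X t \<omega>) k = y k \<and>
                   jump_time (\<lambda>t. X t \<omega>) k + ennreal (s k) < jump_time (\<lambda>t. X t \<omega>) (Suc k))} =
          (if y 0 = x then 1 else 0) *
          (\<Prod>k<n. q (y k) (y (Suc k)) / exit_rate q (y k)) *
          (\<Prod>k\<le>n. exp (- exit_rate q (y k) * s k)))"

text \<open>Families \<open>P x\<close> of laws of one process \<open>X\<close>, indexed by the initial state \<open>x\<close>.\<close>

definition markov_chain ::
    "('s::countable \<Rightarrow> 's \<Rightarrow> real) \<Rightarrow> ('s \<Rightarrow> 'a measure) \<Rightarrow> (real \<Rightarrow> 'a \<Rightarrow> 's) \<Rightarrow> bool" where
  "markov_chain q P X \<longleftrightarrow> (\<forall>x. markov_chain_from q x (P x) X)"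

text \<open>Every state is positive recurrent: it is absorbing or has finite mean return time. This depends
  only on the rates \<open>q\<close>, not on the realisation \<open>P\<close>, \<open>X\<close> of the chain.\<close>

definition positive_recurrent ::
    "('s::countable \<Rightarrow> 's \<Rightarrow> real) \<Rightarrow> ('s \<Rightarrow> 'a measure) \<Rightarrow> (real \<Rightarrow> 'a \<Rightarrow> 's) \<Rightarrow> bool" where
  "positive_recurrent q P X \<longleftrightarrow>
     (\<forall>x. exit_rate q x = 0 \<or> (\<integral>\<^sup>+\<omega>. return_time (\<lambda>t. X t \<omega>) x \<partial>P x) < \<infinity>)"


subsection \<open>The minimum defining \<open>V1\<close> exists\<close>

lemma static_policies_nonempty:
  fixes S :: "'i \<Rightarrow> 'n::finite set"
  assumes "\<And>i. i \<in> I \<Longrightarrow> S i \<noteq> {}"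
  shows "static_policies I S lam \<noteq> {}"
proof -
  have "(\<lambda>i j. if j = (SOME k. k \<in> S i) then 1 else 0) \<in> static_policies I S lam"
    using assms by (auto simp: static_policies_def is_policy_def active_def some_in_eq)
  then show ?thesis by blast
qed

lemma V1_attained:
  fixes S :: "'i \<Rightarrow> 'n::finite set"
  assumes ne: "\<And>i. i \<in> I \<Longrightarrow> S i \<noteq> {}"
  shows "\<exists>p \<in> static_policies I S lam.
    V1 I S lam mu w = max_drift I lam mu w p \<and>
    (\<forall>p' \<in> static_policies I S lam. max_drift I lam mu w p \<le> max_drift I lam mu w p')"
proof -
  let ?A = "static_policies I S lam"
  let ?f = "max_drift I lam mu w"
  define r where "r p = (\<lambda>i j. if i \<in> active I lam then p i j else 0)"
    for p :: "'i \<Rightarrow> 'n \<Rightarrow> real"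
  define B where "B = (\<Pi>\<^sub>E i\<in>(UNIV::'i set). \<Pi>\<^sub>E j\<in>(UNIV::'n set). {0..1::real})"
  define K where "K = B \<inter> ?A"
  have r_in: "r p \<in> K" if "p \<in> ?A" for p
  proof -
    have "0 \<le> p i j \<and> p i j \<le> 1" if "i \<in> active I lam" for i j
    proof -
      have "p i j \<le> (\<Sum>j\<in>UNIV. p i j)"
        using \<open>p \<in> ?A\<close> that
        by (intro member_le_sum) (auto simp: static_policies_def is_policy_def)
      then show ?thesis using \<open>p \<in> ?A\<close> that by (auto simp: static_policies_def is_policy_def)
    qed
    then show ?thesis using \<open>p \<in> ?A\<close>
      by (auto simp: K_def B_def r_def static_policies_def is_policy_def PiE_def)
  qed
  have f_r: "?f (r p) = ?f p" for p
    by (simp add: max_drift_def drift_def r_def)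
  have cB: "compact B"
  proof -
    have 1: "compact (\<Pi>\<^sub>E j\<in>(UNIV::'n set). {0..1::real})"
      using compactin_PiE[of "\<lambda>_. euclidean" "UNIV::'n set" "\<lambda>_. {0..1::real}"]
      by (simp add: euclidean_product_topology)
    show ?thesis unfolding B_def
      using 1 compactin_PiE[of "\<lambda>_. euclidean" "UNIV::'i set" "\<lambda>_. (\<Pi>\<^sub>E j\<in>(UNIV::'n set). {0..1::real})"]
      by (simp add: euclidean_product_topology)
  qed
  have contr: "continuous_on T (\<lambda>p::'i \<Rightarrow> 'n \<Rightarrow> real. p i j)" for T i j
  proof -
    have "continuous_on T (\<lambda>p::'i \<Rightarrow> 'n \<Rightarrow> real. p i)"
      by (rule continuous_on_product_then_coordinatewise[OF continuous_on_id])
    then show ?thesis by (rule continuous_on_product_then_coordinatewise)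
  qed
  have clA: "closed ?A"
  proof -
    have "?A = (\<Inter>i\<in>active I lam. (\<Inter>j. {p. 0 \<le> p i j}) \<inter> {p. (\<Sum>j\<in>UNIV. p i j) = 1} \<inter>
        (\<Inter>j\<in>-S i. {p. p i j = 0}))"
      by (auto simp: static_policies_def is_policy_def)
    also have "closed \<dots>"
      by (intro closed_INT ballI closed_Int closed_Collect_le closed_Collect_eq
            continuous_on_const continuous_on_sum contr)
    finally show ?thesis .
  qed
  have cK: "compact K" unfolding K_def using cB clA by (rule compact_Int_closed)
  have contf: "continuous_on K ?f"
  proof -
    have M: "continuous_on K (\<lambda>p. Max ((\<lambda>j. w j * drift I lam mu p j) ` J))"
      if "finite J" "J \<noteq> {}" for J
      using that
    proof (induction J rule: finite_ne_induct)
      case (singleton j)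
      then show ?case
        by (auto simp: drift_def intro!: continuous_intros contr)
    next
      case (insert j J)
      then show ?case
        by (auto simp: drift_def intro!: continuous_intros contr)
    qed
    show ?thesis unfolding max_drift_def by (rule M) auto
  qed
  have "?A \<noteq> {}" by (rule static_policies_nonempty) (rule ne)
  then have "K \<noteq> {}" using r_in by (metis all_not_in_conv)
  from continuous_attains_inf[OF cK this contf]
  obtain p where p: "p \<in> K" "\<And>p'. p' \<in> K \<Longrightarrow> ?f p \<le> ?f p'" by metis
  have min: "?f p \<le> ?f p'" if "p' \<in> ?A" for p'
    using p(2)[OF r_in[OF that]] f_r by simp
  have "V1 I S lam mu w = ?f p" unfolding V1_def
    using p(1) min by (intro cInf_eq_minimum) (auto simp: K_def)
  with min p(1) show ?thesis by (auto simp: K_def)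
qed

end

theory Submission
  imports Defs
begin

text \<open>
  Say that a static policy is stable if its drift is negative at every station. Whether such a policy
  exists has nothing to do with weights, and both properties in the theorem are equivalent to it as
  long as there are arrivals.

  For the minimax drift this is immediate, since multiplying a drift by a positive weight does not
  change its sign (lemma \<open>V1_neg_iff\<close>).

  For JLW, suppose first that some static policy is stable. The function \<open>\<Sum>j. w j * (x j)\<^sup>2\<close> has, up
  to a bounded term, the drift \<open>2 * (\<Sum>j. w j * x j * (arrival rate at j - mu j))\<close>. Among all routings
  JLW with weights \<open>w\<close> makes this as small as possible, because it sends customers where \<open>w j * x j\<close> is
  least. So the drift is at most that of the stable static policy, which is below \<open>- 1\<close> outside a finite
  set. As the queue under JLW is irreducible (lemma \<open>jlw_irreducible\<close>), Foster's criterion gives positive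
  recurrence (lemma \<open>static_stable_imp_jlw_stable\<close>).
  Conversely, suppose that the queue under some policy has an equilibrium. Average the routing
  probabilities over it. The resulting static policy sends to station \<open>j\<close> exactly the equilibrium
  flow of customers, which must be served while \<open>j\<close> is busy, and \<open>j\<close> is idle for a positive fraction of
  the time. So the flow is less than \<open>mu j\<close> (lemma \<open>stable_imp_static_stable\<close>).

  To make this apply to the mean return times of a concretely given process, the return time to \<open>x\<close> is
  written as the sum of the holding times of one excursion from \<open>x\<close>. Its mean becomes a series over the
  jump chain killed on its return to \<open>x\<close>, weighted with the mean holding times (lemma
  \<open>nn_integral_return_time\<close>), which involves the jump rates only. Foster's criterion bounds
  this series, and if it is finite, its terms form the occupation measure of an excursion, which serves
  as the unnormalised equilibrium. All of these sums take place in the extended non-negative reals.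

  Without arrivals the rates are the same under all policies, and there is nothing to compare.
\<close>

section \<open>Return times as sums of holding times\<close>

lemma jump_time_le_Suc: "jump_time p n \<le> jump_time p (Suc n)"
  by (auto intro!: INF_greatest)

lemma jump_time_mono: "m \<le> n \<Longrightarrow> jump_time p m \<le> jump_time p n"
  by (rule lift_Suc_mono_le[of "jump_time p"]) (auto simp del: jump_time.simps intro: jump_time_le_Suc)

lemma path_between_jumps:
  assumes "0 \<le> t" "jump_time p n \<le> ennreal t" "ennreal t < jump_time p (Suc n)"
  shows "p t = jump_chain p n"
proof (rule ccontr)
  assume "p t \<noteq> jump_chain p n"
  with assms(1,2) have "jump_time p (Suc n) \<le> ennreal t"
    by (auto simp: jump_chain_def intro!: INF_lower)
  with assms(3) show False by simp
qed

text \<open>Right-continuity excludes holding times of length zero. This makes the conditions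
  \<open>jump_time p k + 0 < jump_time p (k + 1)\<close> in the law of a chain vacuous.\<close>

lemma jump_time_less_Suc:
  assumes "jump_time p n < \<top>"
    and "\<And>t. 0 \<le> t \<Longrightarrow> \<exists>e>0. \<forall>s\<in>{t..<t + e}. p s = p t"
  shows "jump_time p n < jump_time p (Suc n)"
proof -
  define t where "t = enn2real (jump_time p n)"
  have t: "0 \<le> t" "jump_time p n = ennreal t"
    using assms(1) by (auto simp: t_def)
  obtain e where e: "e > 0" "\<And>s. s \<in> {t..<t + e} \<Longrightarrow> p s = p t"
    using assms(2)[OF t(1)] by blast
  have "ennreal (t + e) \<le> jump_time p (Suc n)"
    unfolding jump_time.simps(2)
  proof (rule INF_greatest)
    fix s assume "s \<in> {s. 0 \<le> s \<and> jump_time p n \<le> ennreal s \<and>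
      p s \<noteq> p (enn2real (jump_time p n))}"
    then have s: "0 \<le> s" "jump_time p n \<le> ennreal s" "p s \<noteq> p (enn2real (jump_time p n))"
      by auto
    have "t \<le> s" using s t by (simp add: ennreal_le_iff)
    moreover have "s \<notin> {t..<t + e}" using e(2) s(3) by (auto simp: t_def)
    ultimately show "ennreal (t + e) \<le> ennreal s" by (intro ennreal_leI) auto
  qed
  moreover have "ennreal t < ennreal (t + e)" using t(1) e(1) by (intro ennreal_lessI) auto
  ultimately show ?thesis using t(2) by order
qed

text \<open>While this holds for \<open>n\<close>, the path has made its \<open>n\<close>-th jump and has not yet jumped to \<open>x\<close>, so
  the \<open>n\<close>-th holding time is part of the excursion that \<open>return_time p x\<close> measures.\<close>

definition excursion_step :: "(real \<Rightarrow> 's) \<Rightarrow> 's \<Rightarrow> nat \<Rightarrow> bool" where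
  "excursion_step p x n \<longleftrightarrow> jump_time p n < \<top> \<and> (\<forall>k\<in>{1..n}. jump_chain p k \<noteq> x)"

text \<open>Without explosion, every time lies in some interval between consecutive jumps, so the return
  time is the first jump time at which the jump chain is in \<open>x\<close>, and telescoping splits it into
  holding times. If there is no return, both sides are infinite: either some holding time is, or all
  jump times together exhaust the time axis.\<close>

lemma return_time_eq_sum_holding_times:
  assumes nonexplosive: "(SUP n. jump_time p n) = \<top>"
  shows "return_time p x =
    (\<Sum>n. if excursion_step p x n then jump_time p (Suc n) - jump_time p n else 0)"
    (is "_ = (\<Sum>n. ?h n)")
proof -
  let ?T = "jump_time p" and ?E = "excursion_step p x"
  note jump_time.simps(2) [simp del]
  have down: "?E m" if "?E n" "m \<le> n" for m n
    using that jump_time_mono[OF that(2), of p] by (auto simp: excursion_step_def)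
  have E0: "?E 0" by (simp add: excursion_step_def)
  have partial: "(\<Sum>k<n. ?h k) = ?T n" if "\<And>k. k < n \<Longrightarrow> ?E k" for n
    using that
  proof (induction n)
    case (Suc n)
    then have "(\<Sum>k<Suc n. ?h k) = ?T n + (?T (Suc n) - ?T n)" by simp
    then show ?case using jump_time_le_Suc[of p n]
      by (simp add: add.commute diff_add_cancel_ennreal)
  qed simp
  have locate: "\<exists>n\<ge>1. ?T n \<le> ennreal t \<and> jump_chain p n = p t"
    if t: "0 \<le> t" "?T 1 \<le> ennreal t" for t
  proof -
    have "ennreal t < (SUP n. ?T n)" unfolding nonexplosive by simp
    then obtain m where m: "ennreal t < ?T m" unfolding less_SUP_iff by blast
    define l where "l = (LEAST m. ennreal t < ?T m)"
    have l: "ennreal t < ?T l" unfolding l_def using m by (rule LeastI)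
    have "\<not> l \<le> 1" using t(2) l jump_time_mono[of l 1 p] by auto
    then obtain n where n: "l = Suc n" "n \<ge> 1" by (cases l) auto
    have "?T n \<le> ennreal t" using not_less_Least[of n "\<lambda>m. ennreal t < ?T m"] n
      by (auto simp: l_def not_less)
    with path_between_jumps[OF t(1)] l n show ?thesis by metis
  qed
  show ?thesis
  proof (cases "\<forall>n. ?E n")
    case True
    have "(\<Sum>n. ?h n) = (SUP n. \<Sum>k<n. ?h k)" by (rule suminf_eq_SUP)
    also have "\<dots> = (SUP n. ?T n)" by (intro SUP_cong refl partial) (use True in blast)
    finally have "(\<Sum>n. ?h n) = \<top>" using nonexplosive by simp
    moreover have "p t \<noteq> x" if t: "0 \<le> t" "?T 1 \<le> ennreal t" for t
    proof -
      obtain n where "n \<ge> 1" "jump_chain p n = p t" using locate[OF t] by blast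
      moreover have "\<forall>k\<in>{1..n}. jump_chain p k \<noteq> x"
        using True unfolding excursion_step_def by blast
      ultimately show ?thesis by (metis atLeastAtMost_iff order.refl)
    qed
    then have "{t. 0 \<le> t \<and> ?T 1 \<le> ennreal t \<and> p t = x} = {}" by blast
    ultimately show ?thesis unfolding return_time_def by simp
  next
    case False
    define N where "N = (LEAST n. \<not> ?E n)"
    have N: "\<not> ?E N" using False unfolding N_def by (metis LeastI)
    have below: "?E k" if "k < N" for k using that not_less_Least unfolding N_def by blast
    have above: "\<not> ?E k" if "N \<le> k" for k using down N that by blast
    have N1: "N \<ge> 1" using N E0 by (cases N) auto
    have "(\<Sum>n. ?h n) = (\<Sum>k<N. ?h k)"
      using above by (intro suminf_finite) auto
    also have "\<dots> = ?T N" by (rule partial) (rule below)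
    finally have sum: "(\<Sum>n. ?h n) = ?T N" .
    have "?T N \<le> return_time p x" unfolding return_time_def
    proof (rule INF_greatest, clarify)
      fix t assume t: "0 \<le> t" "?T 1 \<le> ennreal t" "x = p t"
      from locate[OF t(1,2)] obtain n where n: "n \<ge> 1" "?T n \<le> ennreal t" "jump_chain p n = p t"
        by blast
      then have "\<not> ?E n" using t(3) by (auto simp: excursion_step_def)
      then have "N \<le> n" using below not_less by blast
      then show "?T N \<le> ennreal t" using jump_time_mono[of N n p] n(2) by (meson order.trans)
    qed
    moreover have "return_time p x \<le> ?T N"
    proof (cases "?T N < \<top>")
      case True
      then have "\<exists>k\<in>{1..N}. jump_chain p k = x" using N by (auto simp: excursion_step_def)
      then have "jump_chain p N = x"
        using below by (fastforce simp: excursion_step_def le_less)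
      then show ?thesis unfolding return_time_def using True jump_time_mono[OF N1, of p]
        by (intro INF_lower2[where i = "enn2real (?T N)"]) (auto simp: jump_chain_def)
    next
      case False
      then show ?thesis by (simp add: not_less top_unique)
    qed
    ultimately show ?thesis using sum by simp
  qed
qed

section \<open>Mean return times in terms of the jump rates\<close>

text \<open>The law of the \<open>n\<close>-th state of the jump chain started at \<open>x\<close>, restricted to trajectories that have
  not returned to \<open>x\<close> by then. Multiplying by the mean holding times and summing over \<open>n\<close> gives the
  mean length of an excursion from \<open>x\<close>, a quantity determined by the rates alone.\<close>

primrec taboo :: "('s \<Rightarrow> 's \<Rightarrow> real) \<Rightarrow> 's \<Rightarrow> nat \<Rightarrow> 's \<Rightarrow> ennreal" where
  "taboo q x 0 z = (if z = x then 1 else 0)"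
| "taboo q x (Suc n) z =
     (if z = x then 0
      else \<integral>\<^sup>+y. taboo q x n y * ennreal (q y z / exit_rate q y) \<partial>count_space UNIV)"

abbreviation excursion_mean :: "('s::countable \<Rightarrow> 's \<Rightarrow> real) \<Rightarrow> 's \<Rightarrow> ennreal" where
  "excursion_mean q x \<equiv>
     (\<Sum>n. \<integral>\<^sup>+z. taboo q x n z * inverse (ennreal (exit_rate q z)) \<partial>count_space UNIV)"

lemma exit_rate_nonneg: "(\<And>y z. 0 \<le> q y z) \<Longrightarrow> 0 \<le> exit_rate q y"
  unfolding exit_rate_def by (rule infsum_nonneg) auto

lemma nn_integral_indicator_shift:
  fixes a b :: ennreal
  assumes "a < \<top>" "a \<le> b"
  shows "(\<integral>\<^sup>+s. (if 0 \<le> s \<and> a + ennreal s < b then 1 else 0) \<partial>lborel) = b - a"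
proof -
  let ?A = "{s. 0 \<le> s \<and> a + ennreal s < b}"
  obtain a' where a': "0 \<le> a'" "a = ennreal a'" using assms(1) by (cases a) auto
  have "(\<integral>\<^sup>+s. (if 0 \<le> s \<and> a + ennreal s < b then 1 else 0) \<partial>lborel)
      = (\<integral>\<^sup>+s. indicator ?A s \<partial>lborel)"
    by (intro nn_integral_cong) (auto simp: indicator_def)
  also have "\<dots> = emeasure lborel ?A" by (rule nn_integral_indicator) measurable
  also have "\<dots> = b - a"
  proof (cases b)
    case (real b')
    then have "?A = {0..<b' - a'}"
      using a' by (auto simp: ennreal_plus[symmetric] ennreal_less_iff simp del: ennreal_plus)
    then show ?thesis using real a' assms by (simp add: ennreal_minus ennreal_le_iff)
  next
    case top
    then have "?A = {0..}" using a' by (auto simp: ennreal_plus[symmetric] simp del: ennreal_plus)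
    moreover have "emeasure lborel {0::real..} = \<top>"
    proof (rule ccontr)
      assume "emeasure lborel {0::real..} \<noteq> \<top>"
      then obtain r where r: "0 \<le> r" "emeasure lborel {0::real..} = ennreal r"
        by (cases "emeasure lborel {0::real..}") auto
      have "ennreal (r + 1) = emeasure lborel {0..r + 1}" using r(1) by simp
      also have "\<dots> \<le> emeasure lborel {0::real..}" by (intro emeasure_mono) auto
      finally show False using r by (simp add: ennreal_le_iff del: ennreal_plus)
    qed
    ultimately show ?thesis using top a' by simp
  qed
  finally show ?thesis .
qed

text \<open>The mean of an exponential holding time, including the absorbing case \<open>r = 0\<close>, where it is
  infinite.\<close>

lemma nn_integral_exp_decay:
  fixes r :: real
  assumes "0 \<le> r"
  shows "(\<integral>\<^sup>+s. (if 0 \<le> s then ennreal (exp (- r * s)) else 0) \<partial>lborel) = inverse (ennreal r)"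
proof (cases "r = 0")
  case True
  have "(\<integral>\<^sup>+s. (if 0 \<le> s then ennreal (exp (- r * s)) else 0) \<partial>lborel)
      = (\<integral>\<^sup>+s. (if 0 \<le> s \<and> 0 + ennreal s < \<top> then 1 else 0) \<partial>lborel)"
    using True by (intro nn_integral_cong) auto
  also have "\<dots> = \<top>" by (subst nn_integral_indicator_shift) auto
  finally show ?thesis using True by simp
next
  case False
  with assms have r: "0 < r" by simp
  have "((\<lambda>s. - exp (- r * s) / r) \<longlongrightarrow> 0) at_top"
    using r by real_asymp
  moreover have "((\<lambda>s. - exp (- r * s) / r) has_real_derivative exp (- r * s)) (at s)" for s
    using r by (auto intro!: derivative_eq_intros)
  ultimately have "(\<integral>\<^sup>+s. ennreal (exp (- r * s)) * indicator {0..} s \<partial>lborel)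
      = ennreal (0 - - exp (- r * 0) / r)"
    by (intro nn_integral_FTC_atLeast) auto
  also have "(\<integral>\<^sup>+s. ennreal (exp (- r * s)) * indicator {0..} s \<partial>lborel)
      = (\<integral>\<^sup>+s. (if 0 \<le> s then ennreal (exp (- r * s)) else 0) \<partial>lborel)"
    by (intro nn_integral_cong) auto
  finally show ?thesis using r by (simp add: inverse_ennreal inverse_eq_divide)
qed

text \<open>The defining law of a chain fixes the whole trajectory \<open>y 0, \<dots>, y n\<close>. Summing over the values of
  the first \<open>m\<close> states one after the other, subject to avoiding \<open>x\<close>, turns the first \<open>m\<close> transition
  factors into \<open>taboo\<close>. The case \<open>m = n\<close> is the joint law of the last state and its holding time.\<close>

lemma excursion_tail_law:
  fixes q :: "'s::countable \<Rightarrow> 's \<Rightarrow> real"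
  assumes mc: "markov_chain_from q x M X" and q: "\<And>y z. 0 \<le> q y z"
    and s: "0 \<le> s" and mn: "m \<le> n"
  defines "T \<equiv> \<lambda>k \<omega>. jump_time (\<lambda>t. X t \<omega>) k" and "Y \<equiv> \<lambda>k \<omega>. jump_chain (\<lambda>t. X t \<omega>) k"
  shows "emeasure M {\<omega> \<in> space M. T n \<omega> < \<top> \<and> (\<forall>k\<in>{1..m}. Y k \<omega> \<noteq> x) \<and>
            (\<forall>k\<in>{m..n}. Y k \<omega> = y k) \<and> T n \<omega> + ennreal s < T (Suc n) \<omega>}
      = taboo q x m (y m) * ennreal (\<Prod>k\<in>{m..<n}. q (y k) (y (Suc k)) / exit_rate q (y k)) *
          ennreal (exp (- exit_rate q (y n) * s))"
proof -
  define E where "E m y = {\<omega> \<in> space M. T n \<omega> < \<top> \<and> (\<forall>k\<in>{1..m}. Y k \<omega> \<noteq> x) \<and>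
      (\<forall>k\<in>{m..n}. Y k \<omega> = y k) \<and> T n \<omega> + ennreal s < T (Suc n) \<omega>}" for m y
  have "emeasure M (E m y) = taboo q x m (y m) *
      ennreal (\<Prod>k\<in>{m..<n}. q (y k) (y (Suc k)) / exit_rate q (y k)) *
      ennreal (exp (- exit_rate q (y n) * s))"
    using mn
  proof (induction m arbitrary: y)
    have [measurable]: "T k \<in> borel_measurable M" "Y k \<in> measurable M (count_space UNIV)" for k
      using mc by (auto simp: markov_chain_from_def T_def Y_def)
    have sets: "E m y \<in> sets M" for m y unfolding E_def by measurable
    have ex: "0 \<le> exit_rate q y" for y by (rule exit_rate_nonneg) (rule q)
    {
      case 0
      interpret prob_space M using mc by (simp add: markov_chain_from_def)
      define s' where "s' k = (if k = n then s else 0)" for k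
      \<comment> \<open>Only the last holding time is constrained; the other conditions hold by right-continuity.\<close>
      let ?L = "{\<omega> \<in> space M. T n \<omega> < \<top> \<and>
          (\<forall>k\<le>n. Y k \<omega> = y k \<and> T k \<omega> + ennreal (s' k) < T (Suc k) \<omega>)}"
      have rc: "AE \<omega> in M. \<forall>t\<ge>0. \<exists>e>0. \<forall>s\<in>{t..<t + e}. X s \<omega> = X t \<omega>"
        using mc by (simp add: markov_chain_from_def)
      have "AE \<omega> in M. \<omega> \<in> E 0 y \<longleftrightarrow> \<omega> \<in> ?L"
        using rc AE_space
      proof eventually_elim
        case (elim \<omega>)
        have "T k \<omega> < T (Suc k) \<omega>" if "T n \<omega> < \<top>" "k \<le> n" for k
          unfolding T_def using elim that jump_time_mono[OF that(2), of "\<lambda>t. X t \<omega>"]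
          by (intro jump_time_less_Suc) (auto simp: T_def)
        then show ?case by (auto simp: s'_def le_less E_def)
      qed
      then have "emeasure M (E 0 y) = emeasure M ?L" by (intro emeasure_eq_AE sets) measurable
      also have "\<dots> = ennreal ((if y 0 = x then 1 else 0) *
            (\<Prod>k<n. q (y k) (y (Suc k)) / exit_rate q (y k)) *
            (\<Prod>k\<le>n. exp (- exit_rate q (y k) * s' k)))"
      proof -
        have "\<forall>n y s. (\<forall>k. 0 \<le> s k) \<longrightarrow>
          measure M {\<omega> \<in> space M. T n \<omega> < \<top> \<and>
              (\<forall>k\<le>n. Y k \<omega> = y k \<and> T k \<omega> + ennreal (s k) < T (Suc k) \<omega>)} =
            (if y 0 = x then 1 else 0) *
            (\<Prod>k<n. q (y k) (y (Suc k)) / exit_rate q (y k)) *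
            (\<Prod>k\<le>n. exp (- exit_rate q (y k) * s k))"
          using mc unfolding markov_chain_from_def T_def Y_def by blast
        moreover have "\<forall>k. 0 \<le> s' k" using s by (simp add: s'_def)
        ultimately show ?thesis unfolding emeasure_eq_measure by presburger
      qed
      also have "(\<Prod>k\<le>n. exp (- exit_rate q (y k) * s' k))
          = (\<Prod>k\<le>n. if k = n then exp (- exit_rate q (y n) * s) else 1)"
        by (intro prod.cong) (auto simp: s'_def)
      also have "\<dots> = exp (- exit_rate q (y n) * s)" by simp
      finally show ?case
        using ex q by (simp add: ennreal_mult prod_nonneg atLeast0LessThan)
    next
      case (Suc m)
      show ?case
      proof (cases "y (Suc m) = x")
        case True
        have "Suc m \<in> {1..Suc m}" "Suc m \<in> {Suc m..n}" using Suc.prems by auto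
        then have "E (Suc m) y = {}" using True unfolding E_def by blast
        then show ?thesis using True by simp
      next
        case False
        let ?c = "ennreal (\<Prod>k\<in>{Suc m..<n}. q (y k) (y (Suc k)) / exit_rate q (y k)) *
            ennreal (exp (- exit_rate q (y n) * s))"
        have "E (Suc m) y = (\<Union>z. E m (y(m := z)))"
        proof (intro equalityI subsetI)
          fix \<omega> assume "\<omega> \<in> E (Suc m) y"
          then have "\<omega> \<in> E m (y(m := Y m \<omega>))" by (auto simp: E_def)
          then show "\<omega> \<in> (\<Union>z. E m (y(m := z)))" by blast
        next
          fix \<omega> assume "\<omega> \<in> (\<Union>z. E m (y(m := z)))"
          then obtain z where z: "\<omega> \<in> E m (y(m := z))" by blast
          have tail: "Y k \<omega> = y k" if "k \<in> {Suc m..n}" for k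
          proof -
            have "Y k \<omega> = (y(m := z)) k" using z that by (simp add: E_def)
            then show ?thesis using that by simp
          qed
          have "Y (Suc m) \<omega> \<noteq> x" using tail[of "Suc m"] False Suc.prems by simp
          then have "\<forall>k\<in>{1..Suc m}. Y k \<omega> \<noteq> x"
            using z by (simp add: E_def atLeastAtMostSuc_conv)
          then show "\<omega> \<in> E (Suc m) y" using z tail by (simp add: E_def)
        qed
        also have "emeasure M \<dots> = (\<integral>\<^sup>+z. emeasure M (E m (y(m := z))) \<partial>count_space UNIV)"
        proof (rule emeasure_UN_countable)
          show "disjoint_family_on (\<lambda>z. E m (y(m := z))) UNIV"
          proof (unfold disjoint_family_on_def, intro ballI impI)
            fix z z' :: 's assume "z \<noteq> z'"
            moreover have "Y m \<omega> = z" if "\<omega> \<in> E m (y(m := z))" for \<omega> z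
            proof -
              have "m \<in> {m..n}" using Suc.prems by simp
              then have "Y m \<omega> = (y(m := z)) m" using that unfolding E_def by blast
              then show ?thesis by simp
            qed
            ultimately show "E m (y(m := z)) \<inter> E m (y(m := z')) = {}" by blast
          qed
        qed (rule sets, rule countableI_type)
        also have "\<dots> = (\<integral>\<^sup>+z. taboo q x m z * ennreal (q z (y (Suc m)) / exit_rate q z) * ?c
            \<partial>count_space UNIV)"
        proof (rule nn_integral_cong)
          fix z
          have "(\<Prod>k\<in>{m..<n}. q ((y(m := z)) k) ((y(m := z)) (Suc k)) / exit_rate q ((y(m := z)) k))
            = q z (y (Suc m)) / exit_rate q z *
              (\<Prod>k\<in>{Suc m..<n}. q (y k) (y (Suc k)) / exit_rate q (y k))"
            using Suc.prems by (simp add: prod.atLeast_Suc_lessThan)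
          moreover have "(y(m := z)) m = z" "(y(m := z)) n = y n" using Suc.prems by auto
          moreover have "m \<le> n" using Suc.prems by simp
          ultimately have "emeasure M (E m (y(m := z))) = taboo q x m z *
              ennreal (q z (y (Suc m)) / exit_rate q z *
                (\<Prod>k\<in>{Suc m..<n}. q (y k) (y (Suc k)) / exit_rate q (y k))) *
              ennreal (exp (- exit_rate q (y n) * s))"
            by (simp only: Suc.IH)
          also have "\<dots> = taboo q x m z * ennreal (q z (y (Suc m)) / exit_rate q z) * ?c"
            using q ex by (subst ennreal_mult) (auto intro!: prod_nonneg simp: mult.assoc)
          finally show "emeasure M (E m (y(m := z)))
              = taboo q x m z * ennreal (q z (y (Suc m)) / exit_rate q z) * ?c" .
        qed
        also have "\<dots> = taboo q x (Suc m) (y (Suc m)) * ?c"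
          using False by (simp add: nn_integral_multc)
        finally show ?thesis by (simp only: mult.assoc)
      qed
    }
  qed
  then show ?thesis unfolding E_def .
qed

text \<open>Each holding time is the integral over \<open>s\<close> of the indicator that it exceeds \<open>s\<close>; by Fubini its mean
  on the event that the \<open>n\<close>-th state is \<open>z\<close> is the integral of the tail probability
  \<open>taboo q x n z * exp (- exit_rate q z * s)\<close>.\<close>

lemma nn_integral_return_time:
  fixes q :: "'s::countable \<Rightarrow> 's \<Rightarrow> real"
  assumes mc: "markov_chain_from q x M X" and q: "\<And>y z. 0 \<le> q y z"
  shows "(\<integral>\<^sup>+\<omega>. return_time (\<lambda>t. X t \<omega>) x \<partial>M) = excursion_mean q x"
proof -
  interpret prob_space M using mc by (simp add: markov_chain_from_def)
  define T where "T k \<omega> = jump_time (\<lambda>t. X t \<omega>) k" for k \<omega>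
  define Y where "Y k \<omega> = jump_chain (\<lambda>t. X t \<omega>) k" for k \<omega>
  have T [measurable]: "T k \<in> borel_measurable M" for k
    unfolding T_def using mc by (simp only: markov_chain_from_def)
  have Y [measurable]: "Y k \<in> measurable M (count_space UNIV)" for k
    unfolding Y_def using mc by (simp only: markov_chain_from_def)
  let ?E = "\<lambda>n \<omega>. T n \<omega> < \<top> \<and> (\<forall>k\<in>{1..n}. Y k \<omega> \<noteq> x)"
  let ?h = "\<lambda>n \<omega>. if ?E n \<omega> then T (Suc n) \<omega> - T n \<omega> else 0"
  let ?g = "\<lambda>n z \<omega> s. if ?E n \<omega> \<and> Y n \<omega> = z \<and> 0 \<le> s \<and> T n \<omega> + ennreal s < T (Suc n) \<omega>
      then 1 else 0 :: ennreal"
  have "(\<integral>\<^sup>+\<omega>. return_time (\<lambda>t. X t \<omega>) x \<partial>M) = (\<integral>\<^sup>+\<omega>. (\<Sum>n. ?h n \<omega>) \<partial>M)"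
  proof (rule nn_integral_cong_AE)
    have "AE \<omega> in M. (SUP n. jump_time (\<lambda>t. X t \<omega>) n) = \<top>"
      using mc by (simp add: markov_chain_from_def)
    then show "AE \<omega> in M. return_time (\<lambda>t. X t \<omega>) x = (\<Sum>n. ?h n \<omega>)"
    proof eventually_elim
      case (elim \<omega>)
      show ?case
        unfolding return_time_eq_sum_holding_times[OF elim] excursion_step_def T_def Y_def ..
    qed
  qed
  also have "\<dots> = (\<Sum>n. \<integral>\<^sup>+\<omega>. ?h n \<omega> \<partial>M)"
    by (rule nn_integral_suminf) measurable
  also have "\<dots> = excursion_mean q x"
  proof (rule suminf_cong)
    fix n
    have h: "?h n \<omega> = (\<integral>\<^sup>+z. \<integral>\<^sup>+s. ?g n z \<omega> s \<partial>lborel \<partial>count_space UNIV)" for \<omega>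
    proof -
      have "(\<integral>\<^sup>+s. ?g n z \<omega> s \<partial>lborel) = ?h n \<omega> * indicator {Y n \<omega>} z" for z
      proof (cases "?E n \<omega> \<and> Y n \<omega> = z")
        case True
        have "(\<integral>\<^sup>+s. ?g n z \<omega> s \<partial>lborel)
          = (\<integral>\<^sup>+s. (if 0 \<le> s \<and> T n \<omega> + ennreal s < T (Suc n) \<omega> then 1 else 0) \<partial>lborel)"
          using True by (intro nn_integral_cong) auto
        also have "\<dots> = T (Suc n) \<omega> - T n \<omega>"
          using True unfolding T_def
          by (intro nn_integral_indicator_shift jump_time_le_Suc) auto
        finally show ?thesis using True by simp
      next
        case False
        then have "?g n z \<omega> s = 0" for s by auto
        then have "(\<integral>\<^sup>+s. ?g n z \<omega> s \<partial>lborel) = 0" by simp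
        then show ?thesis using False by (auto simp: indicator_def)
      qed
      then show ?thesis by (simp add: nn_integral_cmult one_ennreal_def[symmetric])
    qed
    have "(\<integral>\<^sup>+\<omega>. ?h n \<omega> \<partial>M) = (\<integral>\<^sup>+z. \<integral>\<^sup>+\<omega>. \<integral>\<^sup>+s. ?g n z \<omega> s \<partial>lborel \<partial>M \<partial>count_space UNIV)"
      unfolding h by (rule nn_integral_count_space_nn_integral) (simp, measurable)
    also have "\<dots> = (\<integral>\<^sup>+z. taboo q x n z * inverse (ennreal (exit_rate q z)) \<partial>count_space UNIV)"
    proof (rule nn_integral_cong)
      fix z
      interpret pair_sigma_finite lborel M ..
      have "(\<integral>\<^sup>+\<omega>. \<integral>\<^sup>+s. ?g n z \<omega> s \<partial>lborel \<partial>M) = (\<integral>\<^sup>+s. \<integral>\<^sup>+\<omega>. ?g n z \<omega> s \<partial>M \<partial>lborel)"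
        by (rule Fubini') measurable
      also have "\<dots> = (\<integral>\<^sup>+s. taboo q x n z *
          (if 0 \<le> s then ennreal (exp (- exit_rate q z * s)) else 0) \<partial>lborel)"
      proof (rule nn_integral_cong)
        fix s :: real
        show "(\<integral>\<^sup>+\<omega>. ?g n z \<omega> s \<partial>M)
          = taboo q x n z * (if 0 \<le> s then ennreal (exp (- exit_rate q z * s)) else 0)"
        proof (cases "0 \<le> s")
          case True
          let ?A = "{\<omega> \<in> space M. T n \<omega> < \<top> \<and> (\<forall>k\<in>{1..n}. Y k \<omega> \<noteq> x) \<and>
            (\<forall>k\<in>{n..n}. Y k \<omega> = z) \<and> T n \<omega> + ennreal s < T (Suc n) \<omega>}"
          have "(\<integral>\<^sup>+\<omega>. ?g n z \<omega> s \<partial>M) = (\<integral>\<^sup>+\<omega>. indicator ?A \<omega> \<partial>M)"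
            using True by (intro nn_integral_cong) (auto simp: indicator_def)
          also have "\<dots> = emeasure M ?A" by (rule nn_integral_indicator) measurable
          also have "\<dots> = taboo q x n z * ennreal (exp (- exit_rate q z * s))"
            using excursion_tail_law[OF mc q True order.refl, of n "\<lambda>_. z"]
            unfolding T_def Y_def by simp
          finally show ?thesis using True by simp
        next
          case False
          then show ?thesis by simp
        qed
      qed
      also have "\<dots> = taboo q x n z * inverse (ennreal (exit_rate q z))"
        by (subst nn_integral_cmult)
          (auto simp del: minus_mult_left simp: nn_integral_exp_decay exit_rate_nonneg[OF q])
      finally show "(\<integral>\<^sup>+\<omega>. \<integral>\<^sup>+s. ?g n z \<omega> s \<partial>lborel \<partial>M)
        = taboo q x n z * inverse (ennreal (exit_rate q z))" .
    qed
    finally show "(\<integral>\<^sup>+\<omega>. ?h n \<omega> \<partial>M)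
      = (\<integral>\<^sup>+z. taboo q x n z * inverse (ennreal (exit_rate q z)) \<partial>count_space UNIV)" .
  qed
  finally show ?thesis .
qed

text \<open>Positive recurrence depends on the rates only, hence transfers between realisations.\<close>

lemma positive_recurrent_iff:
  assumes "markov_chain q P X" "\<And>y z. 0 \<le> q y z"
  shows "positive_recurrent q P X \<longleftrightarrow> (\<forall>x. exit_rate q x = 0 \<or> excursion_mean q x < \<top>)"
proof -
  have "(\<integral>\<^sup>+\<omega>. return_time (\<lambda>t. X t \<omega>) x \<partial>P x) = excursion_mean q x" for x
    using assms by (intro nn_integral_return_time) (auto simp: markov_chain_def)
  then show ?thesis by (simp add: positive_recurrent_def infinity_ennreal_def)
qed

section \<open>Foster's criterion and the occupation measure\<close>

text \<open>The last assumption says that the possibly infinite sum of the rates out of a state converges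
  and that \<open>q y y = 0\<close>: the diagonal does not enter \<open>exit_rate\<close>.\<close>

locale conservative_rates =
  fixes q :: "'s::countable \<Rightarrow> 's \<Rightarrow> real"
  assumes q_nonneg: "\<And>y z. 0 \<le> q y z"
    and exit_pos: "\<And>y. 0 < exit_rate q y"
    and total_rate: "\<And>y. (\<integral>\<^sup>+z. ennreal (q y z) \<partial>count_space UNIV) = ennreal (exit_rate q y)"
begin

lemma jump_prob_eq:
  "ennreal (q y z / exit_rate q y) = inverse (ennreal (exit_rate q y)) * ennreal (q y z)"
  using exit_pos[of y] q_nonneg[of y z]
  by (simp add: divide_inverse ennreal_mult inverse_ennreal mult.commute)

lemma exit_cancel:
  "inverse (ennreal (exit_rate q y)) * ennreal (exit_rate q y) = 1"
  using exit_pos[of y] by (simp add: inverse_ennreal ennreal_mult[symmetric])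

lemma inverse_exit_finite: "inverse (ennreal (exit_rate q y)) < \<top>"
  using exit_pos[of y] by (simp add: inverse_ennreal)

text \<open>One step of the killed chain, tested against a function \<open>f\<close>; killing at \<open>x\<close> amounts to setting
  \<open>f x\<close> to zero.\<close>

lemma nn_integral_taboo_Suc:
  "(\<integral>\<^sup>+z. taboo q x (Suc n) z * f z \<partial>count_space UNIV) =
   (\<integral>\<^sup>+y. taboo q x n y * inverse (ennreal (exit_rate q y)) *
      (\<integral>\<^sup>+z. ennreal (q y z) * (if z = x then 0 else f z) \<partial>count_space UNIV) \<partial>count_space UNIV)"
proof -
  have "(\<integral>\<^sup>+z. taboo q x (Suc n) z * f z \<partial>count_space UNIV) =
      (\<integral>\<^sup>+z. \<integral>\<^sup>+y. taboo q x n y * inverse (ennreal (exit_rate q y)) *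
        (ennreal (q y z) * (if z = x then 0 else f z)) \<partial>count_space UNIV \<partial>count_space UNIV)"
  proof (rule nn_integral_cong)
    fix z
    show "taboo q x (Suc n) z * f z =
      (\<integral>\<^sup>+y. taboo q x n y * inverse (ennreal (exit_rate q y)) *
        (ennreal (q y z) * (if z = x then 0 else f z)) \<partial>count_space UNIV)"
    proof (cases "z = x")
      case False
      then have "taboo q x (Suc n) z * f z =
        (\<integral>\<^sup>+y. taboo q x n y * ennreal (q y z / exit_rate q y) * f z \<partial>count_space UNIV)"
        by (simp add: nn_integral_multc)
      then show ?thesis using False by (simp add: jump_prob_eq mult.assoc)
    qed simp
  qed
  also have "\<dots> = (\<integral>\<^sup>+y. \<integral>\<^sup>+z. taboo q x n y * inverse (ennreal (exit_rate q y)) *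
        (ennreal (q y z) * (if z = x then 0 else f z)) \<partial>count_space UNIV \<partial>count_space UNIV)"
    by (rule nn_integral_count_space_nn_integral) auto
  finally show ?thesis by (simp add: nn_integral_cmult)
qed

definition first_return :: "'s \<Rightarrow> nat \<Rightarrow> ennreal" where
  "first_return x n =
     (\<integral>\<^sup>+y. taboo q x n y * ennreal (q y x / exit_rate q y) \<partial>count_space UNIV)"

text \<open>Mass leaves the killed chain only through returns to \<open>x\<close>.\<close>

lemma taboo_mass:
  "(\<Sum>k<n. first_return x k) + (\<integral>\<^sup>+z. taboo q x n z \<partial>count_space UNIV) = 1"
proof (induction n)
  case 0
  have "(\<integral>\<^sup>+z. taboo q x 0 z \<partial>count_space UNIV) = (\<integral>\<^sup>+z. indicator {x} z \<partial>count_space UNIV)"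
    by (intro nn_integral_cong) auto
  then show ?case by (simp add: one_ennreal_def[symmetric])
next
  case (Suc n)
  have "first_return x n + (\<integral>\<^sup>+z. taboo q x (Suc n) z \<partial>count_space UNIV)
      = (\<integral>\<^sup>+y. taboo q x n y * inverse (ennreal (exit_rate q y)) *
          (ennreal (q y x) + (\<integral>\<^sup>+z. ennreal (q y z) * (if z = x then 0 else 1) \<partial>count_space UNIV))
          \<partial>count_space UNIV)"
    using nn_integral_taboo_Suc[of x n "\<lambda>_. 1"]
    by (simp add: first_return_def jump_prob_eq distrib_left mult.assoc nn_integral_add[symmetric]
        del: taboo.simps)
  also have "\<dots> = (\<integral>\<^sup>+y. taboo q x n y \<partial>count_space UNIV)"
  proof (rule nn_integral_cong)
    fix y
    have "ennreal (q y x) = (\<integral>\<^sup>+z. ennreal (q y z) * indicator {x} z \<partial>count_space UNIV)"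
      by (simp add: one_ennreal_def[symmetric])
    then have "ennreal (q y x) + (\<integral>\<^sup>+z. ennreal (q y z) * (if z = x then 0 else 1) \<partial>count_space UNIV)
      = (\<integral>\<^sup>+z. ennreal (q y z) * indicator {x} z + ennreal (q y z) * (if z = x then 0 else 1)
          \<partial>count_space UNIV)"
      by (simp add: nn_integral_add)
    also have "\<dots> = (\<integral>\<^sup>+z. ennreal (q y z) \<partial>count_space UNIV)"
      by (intro nn_integral_cong) (auto simp: indicator_def)
    finally show "taboo q x n y * inverse (ennreal (exit_rate q y)) * (ennreal (q y x) +
        (\<integral>\<^sup>+z. ennreal (q y z) * (if z = x then 0 else 1) \<partial>count_space UNIV)) = taboo q x n y"
      by (simp add: total_rate exit_cancel mult.assoc)
  qed
  finally show ?case using Suc.IH by (simp add: add.assoc del: taboo.simps)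
qed

lemma suminf_first_return_le: "(\<Sum>n. first_return x n) \<le> 1"
proof (rule suminf_le_const)
  show "(\<Sum>k<n. first_return x k) \<le> 1" for n
    unfolding taboo_mass[of x n, symmetric] by simp
qed simp

lemma jump_prob_pos: "0 < q y z \<Longrightarrow> 0 < ennreal (q y z / exit_rate q y)"
  using exit_pos[of y] by simp

text \<open>From \<open>y\<close> the chain follows a fixed path to \<open>x\<close> with some positive probability at each visit, and an
  excursion returns to \<open>x\<close> at most once; so the mean number of visits to \<open>y\<close> in an excursion is at most
  the inverse of that probability. The induction goes along the path: visits to \<open>y\<close> are controlled by
  visits to the next state \<open>z\<close>, and by the return itself if \<open>z = x\<close>.\<close>

lemma green_finite:
  assumes "(y, x) \<in> {(y, z). 0 < q y z}\<^sup>*"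
  shows "(\<Sum>n. taboo q x n y) < \<top>"
  using assms
proof (induction rule: converse_rtrancl_induct)
  case base
  have "(\<Sum>n. taboo q x n x) = (\<Sum>n\<in>{0}. taboo q x n x)"
  proof (rule suminf_finite)
    show "taboo q x n x = 0" if "n \<notin> {0}" for n using that by (cases n) auto
  qed auto
  then show ?case by simp
next
  case (step y z)
  let ?p = "ennreal (q y z / exit_rate q y)"
  have p: "0 < ?p" using step by (intro jump_prob_pos) auto
  have "(\<Sum>n. taboo q x n y * ?p) < \<top>"
  proof (cases "z = x")
    case True
    have "(\<Sum>n. taboo q x n y * ?p) \<le> (\<Sum>n. first_return x n)"
      unfolding True first_return_def by (intro suminf_le nn_integral_ge_point) auto
    then show ?thesis using suminf_first_return_le[of x] by (simp add: le_less_trans)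
  next
    case False
    have "(\<Sum>n. taboo q x n y * ?p) \<le> (\<Sum>n. taboo q x (Suc n) z)"
      using False by (intro suminf_le) (auto intro!: nn_integral_ge_point)
    also have "\<dots> \<le> (\<Sum>n. taboo q x n z)"
      by (subst (2) suminf_offset[of _ 1]) (simp_all add: add_increasing)
    finally show ?thesis using step.IH by order
  qed
  then have "(\<Sum>n. taboo q x n y) * ?p < \<top>" by (simp add: ennreal_suminf_multc)
  then show ?case using p by (auto simp: ennreal_mult_less_top)
qed

text \<open>Foster's criterion. Along an excursion, \<open>f\<close> decreases on average by at least the elapsed time,
  except for an increase of at most \<open>c\<close> per unit of time spent in \<open>F\<close>. As \<open>f\<close> is non-negative, the mean
  length of the excursion is bounded by \<open>f x\<close> plus \<open>c\<close> times the mean time in \<open>F\<close>, which is finite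
  because \<open>F\<close> is finite and each of its states is visited finitely often on average.\<close>

lemma foster:
  fixes f :: "'s \<Rightarrow> ennreal"
  assumes drift: "\<And>y. (\<integral>\<^sup>+z. ennreal (q y z) * f z \<partial>count_space UNIV) + 1
      \<le> ennreal (exit_rate q y) * f y + c * indicator F y"
    and F: "finite F" "\<And>y. y \<in> F \<Longrightarrow> (y, x) \<in> {(y, z). 0 < q y z}\<^sup>*"
    and fin: "f x < \<top>" "c < \<top>"
  shows "excursion_mean q x < \<top>"
proof -
  let ?i = "\<lambda>y. inverse (ennreal (exit_rate q y))"
  let ?A = "\<lambda>n. \<integral>\<^sup>+z. taboo q x n z * f z \<partial>count_space UNIV"
  let ?U = "\<lambda>n. \<integral>\<^sup>+z. taboo q x n z * ?i z \<partial>count_space UNIV"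
  let ?G = "\<lambda>n. \<Sum>y\<in>F. taboo q x n y * (?i y * c)"
  have step: "?A (Suc n) + ?U n \<le> ?A n + ?G n" for n
  proof -
    have "?A (Suc n) + ?U n = (\<integral>\<^sup>+y. taboo q x n y * ?i y *
        ((\<integral>\<^sup>+z. ennreal (q y z) * (if z = x then 0 else f z) \<partial>count_space UNIV) + 1)
        \<partial>count_space UNIV)"
      unfolding nn_integral_taboo_Suc by (simp add: distrib_left nn_integral_add)
    also have "\<dots> \<le> (\<integral>\<^sup>+y. taboo q x n y * ?i y *
        (ennreal (exit_rate q y) * f y + c * indicator F y) \<partial>count_space UNIV)"
    proof (rule nn_integral_mono, rule mult_left_mono)
      fix y
      have "(\<integral>\<^sup>+z. ennreal (q y z) * (if z = x then 0 else f z) \<partial>count_space UNIV) + 1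
          \<le> (\<integral>\<^sup>+z. ennreal (q y z) * f z \<partial>count_space UNIV) + 1"
        by (intro add_right_mono nn_integral_mono) simp
      also note drift
      finally show "(\<integral>\<^sup>+z. ennreal (q y z) * (if z = x then 0 else f z) \<partial>count_space UNIV) + 1
          \<le> ennreal (exit_rate q y) * f y + c * indicator F y" .
    qed simp
    also have "\<dots> = (\<integral>\<^sup>+y. taboo q x n y * f y + taboo q x n y * (?i y * c) * indicator F y
        \<partial>count_space UNIV)"
    proof (rule nn_integral_cong)
      fix y
      have "taboo q x n y * ?i y * (ennreal (exit_rate q y) * f y + c * indicator F y)
        = taboo q x n y * (?i y * ennreal (exit_rate q y)) * f y +
          taboo q x n y * (?i y * c) * indicator F y"
        by (simp add: distrib_left mult.assoc)
      then show "taboo q x n y * ?i y * (ennreal (exit_rate q y) * f y + c * indicator F y)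
        = taboo q x n y * f y + taboo q x n y * (?i y * c) * indicator F y"
        by (simp add: exit_cancel)
    qed
    also have "\<dots> = ?A n + (\<integral>\<^sup>+y. taboo q x n y * (?i y * c) \<partial>count_space F)"
      by (simp add: nn_integral_add nn_integral_count_space_indicator)
    also have "\<dots> = ?A n + ?G n" by (simp add: nn_integral_count_space_finite F)
    finally show ?thesis .
  qed
  have sum: "?A n + (\<Sum>k<n. ?U k) \<le> f x + (\<Sum>k<n. ?G k)" for n
  proof (induction n)
    case 0
    have "?A 0 = (\<integral>\<^sup>+z. f z * indicator {x} z \<partial>count_space UNIV)"
      by (intro nn_integral_cong) auto
    then show ?case by simp
  next
    case (Suc n)
    have "?A (Suc n) + (\<Sum>k<Suc n. ?U k) = (?A (Suc n) + ?U n) + (\<Sum>k<n. ?U k)"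
      by (simp add: ac_simps del: taboo.simps)
    also have "\<dots> \<le> (?A n + ?G n) + (\<Sum>k<n. ?U k)" by (intro add_right_mono step)
    also have "\<dots> = (?A n + (\<Sum>k<n. ?U k)) + ?G n" by (simp add: ac_simps)
    also have "\<dots> \<le> (f x + (\<Sum>k<n. ?G k)) + ?G n" by (intro add_right_mono Suc.IH)
    finally show ?case by (simp add: ac_simps del: taboo.simps)
  qed
  have "(\<Sum>n. ?U n) \<le> f x + (\<Sum>n. ?G n)"
  proof (rule suminf_le_const)
    fix n
    have "(\<Sum>k<n. ?U k) \<le> ?A n + (\<Sum>k<n. ?U k)" by simp
    also note sum
    also have "f x + (\<Sum>k<n. ?G k) \<le> f x + (\<Sum>n. ?G n)"
      by (intro add_left_mono sum_le_suminf) auto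
    finally show "(\<Sum>k<n. ?U k) \<le> f x + (\<Sum>n. ?G n)" .
  qed simp
  also have "(\<Sum>n. ?G n) = (\<Sum>y\<in>F. (\<Sum>n. taboo q x n y) * (?i y * c))"
    by (simp add: suminf_sum ennreal_suminf_multc)
  also have "f x + \<dots> < \<top>"
    using fin green_finite[OF F(2)] inverse_exit_finite
    by (auto simp: F(1) ennreal_mult_less_top)
  finally show ?thesis .
qed

text \<open>The mean time spent in \<open>z\<close> during an excursion from \<open>x\<close>. If the excursion has finite mean length,
  this is an unnormalised stationary distribution.\<close>

definition occupation :: "'s \<Rightarrow> 's \<Rightarrow> ennreal" where
  "occupation x z = (\<Sum>n. taboo q x n z) * inverse (ennreal (exit_rate q z))"

lemma nn_integral_occupation:
  "(\<integral>\<^sup>+z. occupation x z \<partial>count_space UNIV) = excursion_mean q x"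
  unfolding occupation_def ennreal_suminf_multc[symmetric] by (rule nn_integral_suminf) auto

lemma occupation_start_pos: "0 < occupation x x"
proof -
  have "taboo q x 0 x \<le> (\<Sum>n. taboo q x n x)"
    using sum_le_suminf[of "\<lambda>n. taboo q x n x" "{0}"] by simp
  then have "0 < (\<Sum>n. taboo q x n x)" by (auto simp: less_le_trans[of 0 1])
  moreover have "0 < inverse (ennreal (exit_rate q x))"
    by (simp add: ennreal_inverse_positive)
  ultimately show ?thesis by (simp add: occupation_def ennreal_zero_less_mult_iff)
qed

text \<open>Stationarity of the occupation measure, tested against \<open>f\<close>. The requirement \<open>f x = 0\<close> removes the
  contributions of the start in \<open>x\<close> and of the return to \<open>x\<close>.\<close>

lemma occupation_balance:
  assumes "f x = 0"
  shows "(\<integral>\<^sup>+y. occupation x y * (\<integral>\<^sup>+z. ennreal (q y z) * f z \<partial>count_space UNIV) \<partial>count_space UNIV)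
    = (\<integral>\<^sup>+z. occupation x z * (ennreal (exit_rate q z) * f z) \<partial>count_space UNIV)"
proof -
  let ?i = "\<lambda>y. inverse (ennreal (exit_rate q y))"
  have f: "(if z = x then 0 else f z) = f z" for z using assms by simp
  have "(\<integral>\<^sup>+y. occupation x y * (\<integral>\<^sup>+z. ennreal (q y z) * f z \<partial>count_space UNIV) \<partial>count_space UNIV)
      = (\<integral>\<^sup>+y. (\<Sum>n. taboo q x n y * ?i y * (\<integral>\<^sup>+z. ennreal (q y z) * f z \<partial>count_space UNIV))
          \<partial>count_space UNIV)"
    by (simp add: occupation_def ennreal_suminf_multc)
  also have "\<dots> = (\<Sum>n. \<integral>\<^sup>+z. taboo q x (Suc n) z * f z \<partial>count_space UNIV)"
    unfolding nn_integral_taboo_Suc f by (rule nn_integral_suminf) auto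
  also have "\<dots> = (\<Sum>n. \<integral>\<^sup>+z. taboo q x n z * f z \<partial>count_space UNIV)"
  proof -
    have "(\<integral>\<^sup>+z. taboo q x 0 z * f z \<partial>count_space UNIV) = (\<integral>\<^sup>+(z::'s). 0 \<partial>count_space UNIV)"
      using assms by (intro nn_integral_cong) auto
    then show ?thesis
      by (subst (2) suminf_offset[of _ 1]) (simp_all del: taboo.simps)
  qed
  also have "\<dots> = (\<integral>\<^sup>+z. (\<Sum>n. taboo q x n z) * f z \<partial>count_space UNIV)"
    by (subst nn_integral_suminf[symmetric]) auto
  also have "\<dots> = (\<integral>\<^sup>+z. occupation x z * (ennreal (exit_rate q z) * f z) \<partial>count_space UNIV)"
  proof (rule nn_integral_cong)
    fix z
    have "occupation x z * (ennreal (exit_rate q z) * f z)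
      = (\<Sum>n. taboo q x n z) * (?i z * ennreal (exit_rate q z)) * f z"
      by (simp add: occupation_def mult.assoc)
    then show "(\<Sum>n. taboo q x n z) * f z = occupation x z * (ennreal (exit_rate q z) * f z)"
      by (simp add: exit_cancel)
  qed
  finally show ?thesis .
qed

end

section \<open>The queue length process\<close>

lemma has_sum_point_mass:
  assumes "b \<in> A"
  shows "((\<lambda>y. if y = b then c else 0 :: real) has_sum c) A"
  using assms by (intro has_sum_finite_neutralI[of "{b}"]) auto

lemma has_sum_sum:
  fixes f :: "'j \<Rightarrow> 's \<Rightarrow> real"
  assumes "finite J" "\<And>j. j \<in> J \<Longrightarrow> (f j has_sum c j) A"
  shows "((\<lambda>y. \<Sum>j\<in>J. f j y) has_sum (\<Sum>j\<in>J. c j)) A"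
  using assms by (induction J rule: finite_induct) (auto intro!: has_sum_add)

lemma sum_fun_upd:
  fixes g :: "'n::finite \<Rightarrow> 'b \<Rightarrow> real"
  shows "(\<Sum>l\<in>UNIV. g l ((y(j := v)) l)) = (\<Sum>l\<in>UNIV. g l (y l)) + (g j v - g j (y j))"
proof -
  have "(\<Sum>l\<in>UNIV. g l ((y(j := v)) l)) = (\<Sum>l\<in>UNIV. g l (y l) + (if l = j then g j v - g j (y j) else 0))"
    by (intro sum.cong) auto
  then show ?thesis by (simp add: sum.distrib)
qed

locale network =
  fixes I :: "'i set" and S :: "'i \<Rightarrow> 'n::finite set"
    and lam :: "'i \<Rightarrow> real" and mu :: "'n \<Rightarrow> real"
  assumes finite_I: "finite I"
    and S_nonempty: "\<And>i. i \<in> I \<Longrightarrow> S i \<noteq> {}"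
    and mu_pos: "\<And>j. 0 < mu j"
    and connected: "network_connected I S lam"
    and active_nonempty: "active I lam \<noteq> {}"
begin

abbreviation "arr \<equiv> arrival_rate I S lam"
abbreviation "rate \<equiv> queue_rate I S lam mu"
abbreviation "policy \<equiv> is_policy I S lam"

lemma finite_active: "finite (active I lam)"
  using finite_I by (simp add: active_def)

lemma lam_pos: "i \<in> active I lam \<Longrightarrow> 0 < lam i"
  by (simp add: active_def)

lemma policyD:
  assumes "policy \<pi>" "i \<in> active I lam"
  shows "0 \<le> \<pi> x i j" "(\<Sum>j\<in>UNIV. \<pi> x i j) = 1" "j \<notin> S i \<Longrightarrow> \<pi> x i j = 0" "\<pi> x i j \<le> 1"
proof -
  show *: "0 \<le> \<pi> x i j" "(\<Sum>j\<in>UNIV. \<pi> x i j) = 1" "j \<notin> S i \<Longrightarrow> \<pi> x i j = 0" for j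
    using assms by (auto simp: is_policy_def)
  show "\<pi> x i j \<le> 1" unfolding *(2)[symmetric]
    by (rule member_le_sum) (use *(1) in auto)
qed

text \<open>The path that connects a station to an active neighbourhood leaves the station along an edge.\<close>

lemma station_in_active_neighbourhood: "\<exists>i\<in>active I lam. j \<in> S i"
proof -
  obtain i0 where "i0 \<in> active I lam" using active_nonempty by blast
  then have "(Inr j, Inl i0) \<in> (edges I S lam \<union> (edges I S lam)\<inverse>)\<^sup>*"
    using connected by (auto simp: network_connected_def nodes_def)
  then obtain v where "(Inr j, v) \<in> edges I S lam \<union> (edges I S lam)\<inverse>"
    by (cases rule: converse_rtranclE) auto
  then show ?thesis by (auto simp: edges_def)
qed

lemma arrival_rate_eq:
  assumes "policy \<pi>"
  shows "arr \<pi> x j = (\<Sum>i\<in>active I lam. lam i * \<pi> (\<lambda>k. int (x k)) i j)"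
  unfolding arrival_rate_def using finite_active policyD[OF assms]
  by (intro sum.mono_neutral_left) auto

lemma arrival_rate_nonneg: "policy \<pi> \<Longrightarrow> 0 \<le> arr \<pi> x j"
  by (auto simp: arrival_rate_eq policyD intro!: sum_nonneg mult_nonneg_nonneg dest: lam_pos)

lemma arrival_rate_le: "policy \<pi> \<Longrightarrow> arr \<pi> x j \<le> sum lam (active I lam)"
  unfolding arrival_rate_eq
  by (intro sum_mono mult_left_le) (auto simp: policyD dest: lam_pos)

text \<open>Writing the rates as a finite sum of point masses lets sums over all target states be taken
  station by station.\<close>

lemma queue_rate_point_masses:
  "rate \<pi> x y = (\<Sum>j\<in>UNIV. if y = x(j := x j + 1) then arr \<pi> x j else 0) +
     (\<Sum>j\<in>{j. 1 \<le> x j}. if y = x(j := x j - 1) then mu j else 0)"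
proof -
  have "{j. 1 \<le> x j \<and> y = x(j := x j - 1)} = {j\<in>{j. 1 \<le> x j}. y = x(j := x j - 1)}"
    "{j. y = x(j := x j + 1)} = {j\<in>UNIV. y = x(j := x j + 1)}" by auto
  then show ?thesis unfolding queue_rate_def by (simp only: sum.inter_filter finite)
qed

lemma queue_rate_nonneg: "policy \<pi> \<Longrightarrow> 0 \<le> rate \<pi> x y"
  unfolding queue_rate_def
  by (intro add_nonneg_nonneg sum_nonneg) (auto simp: arrival_rate_nonneg less_imp_le mu_pos)

lemma exit_rate_eq:
  "exit_rate (rate \<pi>) x = (\<Sum>j\<in>UNIV. arr \<pi> x j) + (\<Sum>j\<in>{j. 1 \<le> x j}. mu j)"
proof -
  have neq: "x(j := x j + 1) \<noteq> x" "1 \<le> x j \<Longrightarrow> x(j := x j - 1) \<noteq> x" for j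
    by (auto simp: fun_eq_iff)
  have "(rate \<pi> x has_sum ((\<Sum>j\<in>UNIV. arr \<pi> x j) + (\<Sum>j\<in>{j. 1 \<le> x j}. mu j))) (- {x})"
    unfolding queue_rate_point_masses[abs_def]
    by (intro has_sum_add has_sum_sum has_sum_point_mass) (use neq in auto)
  then show ?thesis unfolding exit_rate_def by (rule infsumI)
qed

text \<open>Subtracting \<open>exit_rate (rate \<pi>) x * f x\<close> from the right-hand side gives the generator of the queue
  length process, applied to \<open>f\<close>. The two parts are kept apart because \<^typ>\<open>ennreal\<close> has no proper
  subtraction.\<close>

lemma nn_integral_queue_rate:
  assumes "policy \<pi>"
  shows "(\<integral>\<^sup>+y. ennreal (rate \<pi> x y) * f y \<partial>count_space UNIV) =
    (\<Sum>j\<in>UNIV. ennreal (arr \<pi> x j) * f (x(j := x j + 1))) +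
    (\<Sum>j\<in>{j. 1 \<le> x j}. ennreal (mu j) * f (x(j := x j - 1)))"
proof -
  have "ennreal (rate \<pi> x y) * f y =
      (\<Sum>j\<in>UNIV. ennreal (arr \<pi> x j) * f y * indicator {x(j := x j + 1)} y) +
      (\<Sum>j\<in>{j. 1 \<le> x j}. ennreal (mu j) * f y * indicator {x(j := x j - 1)} y)" for y
  proof -
    have "ennreal (rate \<pi> x y) =
        ennreal (\<Sum>j\<in>UNIV. if y = x(j := x j + 1) then arr \<pi> x j else 0) +
        ennreal (\<Sum>j\<in>{j. 1 \<le> x j}. if y = x(j := x j - 1) then mu j else 0)"
      unfolding queue_rate_point_masses using arrival_rate_nonneg[OF assms] mu_pos
      by (intro ennreal_plus sum_nonneg) (simp_all add: less_imp_le)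
    also have "\<dots> = (\<Sum>j\<in>UNIV. ennreal (if y = x(j := x j + 1) then arr \<pi> x j else 0)) +
        (\<Sum>j\<in>{j. 1 \<le> x j}. ennreal (if y = x(j := x j - 1) then mu j else 0))"
      using arrival_rate_nonneg[OF assms] mu_pos
      by (intro arg_cong2[where f = "(+)"] sum_ennreal[symmetric]) (simp_all add: less_imp_le)
    finally have *: "ennreal (rate \<pi> x y) = \<dots>" .
    show ?thesis unfolding * distrib_right sum_distrib_right
      by (intro arg_cong2[where f = "(+)"] sum.cong refl) (simp_all add: indicator_def)
  qed
  then have "(\<integral>\<^sup>+y. ennreal (rate \<pi> x y) * f y \<partial>count_space UNIV) = (\<integral>\<^sup>+y.
      (\<Sum>j\<in>UNIV. ennreal (arr \<pi> x j) * f y * indicator {x(j := x j + 1)} y) +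
      (\<Sum>j\<in>{j. 1 \<le> x j}. ennreal (mu j) * f y * indicator {x(j := x j - 1)} y)
      \<partial>count_space UNIV)" by simp
  also have "\<dots> = (\<Sum>j\<in>UNIV. \<integral>\<^sup>+y. ennreal (arr \<pi> x j) * f y * indicator {x(j := x j + 1)} y
        \<partial>count_space UNIV) +
      (\<Sum>j\<in>{j. 1 \<le> x j}. \<integral>\<^sup>+y. ennreal (mu j) * f y * indicator {x(j := x j - 1)} y
        \<partial>count_space UNIV)"
    by (simp only: nn_integral_add nn_integral_sum borel_measurable_count_space)
  also have "\<dots> = (\<Sum>j\<in>UNIV. ennreal (arr \<pi> x j) * f (x(j := x j + 1))) +
      (\<Sum>j\<in>{j. 1 \<le> x j}. ennreal (mu j) * f (x(j := x j - 1)))"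
    by (subst (1 2) nn_integral_indicator_singleton) simp_all
  finally show ?thesis .
qed

lemma service_step: "policy \<pi> \<Longrightarrow> 1 \<le> x j \<Longrightarrow> 0 < rate \<pi> x (x(j := x j - 1))"
  unfolding queue_rate_def
  by (intro add_nonneg_pos sum_nonneg sum_pos2[of _ j])
    (auto simp: arrival_rate_nonneg mu_pos less_imp_le)

lemma arrival_step:
  assumes "policy \<pi>" "0 < arr \<pi> x j"
  shows "0 < rate \<pi> x (x(j := x j + 1))"
  unfolding queue_rate_def
  by (intro add_pos_nonneg sum_nonneg sum_pos2[of _ j])
    (use assms in \<open>auto simp: arrival_rate_nonneg mu_pos less_imp_le\<close>)

lemma sum_arrival_rate:
  assumes "policy \<pi>"
  shows "(\<Sum>j\<in>UNIV. arr \<pi> x j) = sum lam (active I lam)"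
proof -
  have "(\<Sum>j\<in>UNIV. arr \<pi> x j) =
      (\<Sum>i\<in>active I lam. lam i * (\<Sum>j\<in>UNIV. \<pi> (\<lambda>k. int (x k)) i j))"
    by (simp add: arrival_rate_eq[OF assms] sum_distrib_left sum.swap[of _ UNIV])
  then show ?thesis by (simp add: policyD[OF assms])
qed

lemma total_arrivals_pos: "0 < sum lam (active I lam)"
  using finite_active active_nonempty lam_pos by (intro sum_pos) auto

lemma conservative_rates_queue:
  assumes "policy \<pi>"
  shows "conservative_rates (rate \<pi>)"
proof
  show "0 \<le> rate \<pi> y z" for y z by (rule queue_rate_nonneg) fact
  show "0 < exit_rate (rate \<pi>) y" for y
    unfolding exit_rate_eq sum_arrival_rate[OF assms] using total_arrivals_pos
    by (intro add_pos_nonneg sum_nonneg) (auto simp: mu_pos less_imp_le)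
  fix y
  have "(\<integral>\<^sup>+z. ennreal (rate \<pi> y z) \<partial>count_space UNIV)
      = (\<Sum>j\<in>UNIV. ennreal (arr \<pi> y j)) + (\<Sum>j\<in>{j. 1 \<le> y j}. ennreal (mu j))"
    using nn_integral_queue_rate[OF assms, of y "\<lambda>_. 1"] by (simp only: mult_1_right)
  also have "\<dots> = ennreal (\<Sum>j\<in>UNIV. arr \<pi> y j) + ennreal (\<Sum>j\<in>{j. 1 \<le> y j}. mu j)"
    using arrival_rate_nonneg[OF assms] mu_pos
    by (intro arg_cong2[where f = "(+)"] sum_ennreal) (simp_all add: less_imp_le)
  also have "\<dots> = ennreal (exit_rate (rate \<pi>) y)"
    unfolding exit_rate_eq using arrival_rate_nonneg[OF assms] mu_pos
    by (intro ennreal_plus[symmetric] sum_nonneg) (simp_all add: less_imp_le)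
  finally show "(\<integral>\<^sup>+z. ennreal (rate \<pi> y z) \<partial>count_space UNIV) = ennreal (exit_rate (rate \<pi>) y)" .
qed

lemma exit_rate_le:
  assumes "policy \<pi>"
  shows "exit_rate (rate \<pi>) x \<le> sum lam (active I lam) + (\<Sum>j\<in>UNIV. mu j)"
  unfolding exit_rate_eq sum_arrival_rate[OF assms]
  by (intro add_left_mono sum_mono2) (auto simp: mu_pos less_imp_le)

section \<open>Stability of JLW policies from a stable static policy\<close>

lemma jlw_argmin_nonempty: "S i \<noteq> {} \<Longrightarrow> jlw_argmin S w x i \<noteq> {}"
  unfolding jlw_argmin_def
  using Min_in[of "(\<lambda>l. w l * real_of_int (x l)) ` S i"] by fastforce

lemma jlw_policy: "policy (jlw S w)"
  unfolding is_policy_def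
proof (intro allI ballI)
  fix x i assume "i \<in> active I lam"
  then have "S i \<noteq> {}" using S_nonempty by (auto simp: active_def)
  from jlw_argmin_nonempty[OF this]
  have "card (jlw_argmin S w x i) > 0" by (simp add: card_gt_0_iff)
  moreover have "jlw_argmin S w x i \<subseteq> S i" by (auto simp: jlw_argmin_def)
  ultimately show "(\<forall>j. 0 \<le> jlw S w x i j) \<and> (\<Sum>j\<in>UNIV. jlw S w x i j) = 1 \<and>
      (\<forall>j. j \<notin> S i \<longrightarrow> jlw S w x i j = 0)"
    by (auto simp: jlw_def sum.If_cases)
qed

text \<open>JLW sends every customer of neighbourhood \<open>i\<close> to a station where \<open>w j * x j\<close> is minimal on \<open>S i\<close>,
  while any other policy averages the same quantity over \<open>S i\<close>.\<close>

lemma jlw_minimizes: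
  assumes i: "i \<in> active I lam" and p: "p \<in> static_policies I S lam"
  shows "(\<Sum>j\<in>UNIV. w j * real (x j) * jlw S w (\<lambda>k. int (x k)) i j)
      \<le> (\<Sum>j\<in>UNIV. w j * real (x j) * p i j)"
proof -
  have pol: "policy (\<lambda>_. p)" using p by (simp add: static_policies_def)
  let ?m = "MIN l\<in>S i. w l * real_of_int (int (x l))"
  have "(\<Sum>j\<in>UNIV. w j * real (x j) * jlw S w (\<lambda>k. int (x k)) i j)
      = (\<Sum>j\<in>UNIV. ?m * jlw S w (\<lambda>k. int (x k)) i j)"
    by (intro sum.cong) (auto simp: jlw_def jlw_argmin_def)
  also have "\<dots> = (\<Sum>j\<in>UNIV. ?m * p i j)"
    using policyD(2)[OF jlw_policy i, of w] policyD(2)[OF pol i]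
    by (simp add: sum_distrib_left[symmetric])
  also have "\<dots> \<le> (\<Sum>j\<in>UNIV. w j * real (x j) * p i j)"
  proof (rule sum_mono)
    fix j
    show "?m * p i j \<le> w j * real (x j) * p i j"
    proof (cases "j \<in> S i")
      case True
      then have "?m \<le> w j * real_of_int (int (x j))" by (intro Min_le) auto
      then show ?thesis using policyD(1)[OF pol i] by (intro mult_right_mono) auto
    qed (use policyD(3)[OF pol i] in simp)
  qed
  finally show ?thesis .
qed

lemma jlw_arrivals_minimize:
  assumes p: "p \<in> static_policies I S lam"
  shows "(\<Sum>j\<in>UNIV. w j * real (x j) * arr (jlw S w) x j)
      \<le> (\<Sum>j\<in>UNIV. w j * real (x j) * (drift I lam mu p j + mu j))"
proof -
  have "(\<Sum>j\<in>UNIV. w j * real (x j) * arr (jlw S w) x j)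
      = (\<Sum>i\<in>active I lam. lam i * (\<Sum>j\<in>UNIV. w j * real (x j) * jlw S w (\<lambda>k. int (x k)) i j))"
    by (simp add: arrival_rate_eq[OF jlw_policy] sum_distrib_left sum.swap[of _ UNIV] mult_ac)
  also have "\<dots> \<le> (\<Sum>i\<in>active I lam. lam i * (\<Sum>j\<in>UNIV. w j * real (x j) * p i j))"
    using p by (intro sum_mono mult_left_mono jlw_minimizes) (auto dest: lam_pos)
  also have "\<dots> = (\<Sum>j\<in>UNIV. w j * real (x j) * (drift I lam mu p j + mu j))"
    by (simp add: drift_def sum_distrib_left sum.swap[of _ UNIV] mult_ac)
  finally show ?thesis .
qed

text \<open>A station that minimises \<open>w j * y j\<close> over the whole network minimises it in each of its
  neighbourhoods, so JLW can send the next customer there. Unless the state already dominates \<open>x\<close>, the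
  weighted length at that station is below \<open>L\<close>, the largest weighted length in \<open>x\<close>. Hence only
  finitely many such arrivals can occur before the state dominates \<open>x\<close>.\<close>

lemma jlw_reaches_above:
  assumes w: "\<And>j. 0 < w j"
  shows "\<exists>z. (\<forall>j. x j \<le> z j) \<and> (y, z) \<in> {(y, z). 0 < rate (jlw S w) y z}\<^sup>*"
proof -
  let ?R = "{(y, z). 0 < rate (jlw S w) y z}"
  define L where "L = Max (range (\<lambda>j. w j * real (x j)))"
  have L: "w j * real (x j) \<le> L" for j unfolding L_def by (intro Max_ge) auto
  have "\<exists>c::nat. L \<le> w j * real c" for j
    using reals_Archimedean3[OF w, of j] by (metis less_imp_le mult.commute)
  then obtain c :: "'n \<Rightarrow> nat" where c: "\<And>j. L \<le> w j * real (c j)" by metis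
  show ?thesis
  proof (induction "\<Sum>j\<in>UNIV. c j - y j" arbitrary: y rule: less_induct)
    case less
    show ?case
    proof (cases "\<forall>j. x j \<le> y j")
      case True
      then show ?thesis by blast
    next
      case False
      then obtain k where k: "y k < x k" by (auto simp: not_le)
      have "finite (range (\<lambda>j. w j * real (y j)))" "range (\<lambda>j. w j * real (y j)) \<noteq> {}" by auto
      from Min_in[OF this] obtain j where
        j: "Min (range (\<lambda>j. w j * real (y j))) = w j * real (y j)" by (rule imageE)
      have least: "w j * real (y j) \<le> w l * real (y l)" for l
        unfolding j[symmetric] by (intro Min_le) auto
      have "w j * real (y j) \<le> w k * real (y k)" by (rule least)
      also have "\<dots> < w k * real (x k)" using k w by simp
      also have "\<dots> \<le> L" by (rule L)
      also have "\<dots> \<le> w j * real (c j)" by (rule c)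
      finally have yc: "y j < c j" using w[of j] by (simp add: mult_less_cancel_left_pos)
      obtain i where i: "i \<in> active I lam" "j \<in> S i"
        using station_in_active_neighbourhood by blast
      have "w j * real (y j) = (MIN l\<in>S i. w l * real (y l))"
        using i least by (intro Min_eqI[symmetric]) auto
      then have "j \<in> jlw_argmin S w (\<lambda>k. int (y k)) i" using i by (simp add: jlw_argmin_def)
      then have "0 < jlw S w (\<lambda>k. int (y k)) i j"
        by (auto simp: jlw_def card_gt_0_iff)
      then have "0 < arr (jlw S w) y j"
        unfolding arrival_rate_eq[OF jlw_policy] using i finite_active policyD(1)[OF jlw_policy]
        by (intro sum_pos2[of _ i]) (auto simp: lam_pos less_imp_le)
      from arrival_step[OF jlw_policy this] have step: "(y, y(j := y j + 1)) \<in> ?R" by simp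
      have "(\<Sum>l\<in>UNIV. c l - (y(j := y j + 1)) l) < (\<Sum>l\<in>UNIV. c l - y l)"
        using yc by (intro sum_strict_mono_ex1[OF finite]) (simp, rule bexI[of _ j], simp_all)
      from less[OF this] obtain z where
        z: "\<forall>j. x j \<le> z j" "(y(j := y j + 1), z) \<in> ?R\<^sup>*" by blast
      show ?thesis using z(1) converse_rtrancl_into_rtrancl[OF step z(2)] by blast
    qed
  qed
qed

lemma reaches_below:
  assumes "policy \<pi>" "\<And>j. x j \<le> z j"
  shows "(z, x) \<in> {(y, z). 0 < rate \<pi> y z}\<^sup>*"
  using assms(2)
proof (induction "\<Sum>j\<in>UNIV. z j" arbitrary: z rule: less_induct)
  case less
  show ?case
  proof (cases "z = x")
    case False
    then obtain j where "z j \<noteq> x j" by auto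
    then have j: "x j < z j" using less.prems[of j] by simp
    have "(\<Sum>l\<in>UNIV. (z(j := z j - 1)) l) < (\<Sum>l\<in>UNIV. z l)"
      using j by (intro sum_strict_mono_ex1[OF finite]) (simp, rule bexI[of _ j], simp_all)
    then have "(z(j := z j - 1), x) \<in> {(y, z). 0 < rate \<pi> y z}\<^sup>*"
    proof (rule less.hyps)
      show "x l \<le> (z(j := z j - 1)) l" for l using j less.prems[of l] by (cases "l = j") auto
    qed
    moreover have "(z, z(j := z j - 1)) \<in> {(y, z). 0 < rate \<pi> y z}"
      using j service_step[OF assms(1), of z j] by simp
    ultimately show ?thesis by (rule converse_rtrancl_into_rtrancl[rotated])
  qed simp
qed

text \<open>Arrivals lead to a state above \<open>x\<close>, and services lead down from there to \<open>x\<close>. Irreducibility is what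
  turns finite mean return to a finite set into positive recurrence of every state.\<close>

lemma jlw_irreducible:
  assumes "\<And>j. 0 < w j"
  shows "(y, x) \<in> {(y, z). 0 < rate (jlw S w) y z}\<^sup>*"
proof -
  have "\<exists>z. (\<forall>j. x j \<le> z j) \<and> (y, z) \<in> {(y, z). 0 < rate (jlw S w) y z}\<^sup>*"
    by (rule jlw_reaches_above) (rule assms)
  then obtain z where z: "\<forall>j. x j \<le> z j" "(y, z) \<in> {(y, z). 0 < rate (jlw S w) y z}\<^sup>*"
    by (elim exE conjE)
  show ?thesis by (rule rtrancl_trans[OF z(2) reaches_below[OF jlw_policy]]) (use z(1) in simp)
qed

text \<open>The drift of the quadratic function \<open>\<Sum>j. w j * (y j)\<^sup>2\<close>, with each increment written out. Its
  leading part \<open>2 * (\<Sum>j. w j * y j * (arr j - mu j))\<close> is smallest under JLW, hence at most its value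
  under the static policy \<open>p\<close>, which is linear and negative in the queue lengths; \<open>B\<close> bounds the rest.\<close>

lemma jlw_quadratic_drift:
  assumes w: "\<And>j. 0 < w j" and p: "p \<in> static_policies I S lam"
    and \<epsilon>: "\<And>j. 2 * (w j * drift I lam mu p j) \<le> - \<epsilon>"
  defines "B \<equiv> \<Sum>j\<in>UNIV. w j * (sum lam (active I lam) + mu j)"
  shows "(\<Sum>j\<in>UNIV. arr (jlw S w) y j * (w j * (2 * real (y j) + 1))) +
     (\<Sum>j\<in>{j. 1 \<le> y j}. mu j * (w j * (1 - 2 * real (y j))))
   \<le> B - \<epsilon> * (\<Sum>j\<in>UNIV. real (y j))"
proof -
  let ?a = "arr (jlw S w) y" and ?L = "sum lam (active I lam)"
  have "(\<Sum>j\<in>{j. 1 \<le> y j}. mu j * (w j * (1 - 2 * real (y j))))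
      \<le> (\<Sum>j\<in>UNIV. mu j * (w j * (1 - 2 * real (y j))))"
    using w mu_pos by (intro sum_mono2) (auto simp: less_imp_le)
  moreover have "(\<Sum>j\<in>UNIV. ?a j * (w j * (2 * real (y j) + 1)))
      \<le> 2 * (\<Sum>j\<in>UNIV. w j * real (y j) * ?a j) + (\<Sum>j\<in>UNIV. w j * ?L)"
  proof -
    have "(\<Sum>j\<in>UNIV. ?a j * (w j * (2 * real (y j) + 1)))
      = 2 * (\<Sum>j\<in>UNIV. w j * real (y j) * ?a j) + (\<Sum>j\<in>UNIV. w j * ?a j)"
      by (simp add: sum_distrib_left sum.distrib[symmetric] algebra_simps)
    also have "(\<Sum>j\<in>UNIV. w j * ?a j) \<le> (\<Sum>j\<in>UNIV. w j * ?L)"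
      using arrival_rate_le[OF jlw_policy] w by (intro sum_mono mult_left_mono) (auto simp: less_imp_le)
    finally show ?thesis by simp
  qed
  moreover have "(\<Sum>j\<in>UNIV. w j * real (y j) * ?a j)
      \<le> (\<Sum>j\<in>UNIV. w j * real (y j) * (drift I lam mu p j + mu j))"
    by (rule jlw_arrivals_minimize[OF p])
  moreover have "2 * (\<Sum>j\<in>UNIV. w j * real (y j) * (drift I lam mu p j + mu j)) +
      (\<Sum>j\<in>UNIV. w j * ?L) + (\<Sum>j\<in>UNIV. mu j * (w j * (1 - 2 * real (y j))))
      = B + (\<Sum>j\<in>UNIV. 2 * (w j * drift I lam mu p j) * real (y j))"
    unfolding B_def by (simp add: sum_distrib_left sum.distrib[symmetric] algebra_simps)
  moreover have "(\<Sum>j\<in>UNIV. 2 * (w j * drift I lam mu p j) * real (y j))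
      \<le> (\<Sum>j\<in>UNIV. - \<epsilon> * real (y j))"
    by (intro sum_mono mult_right_mono \<epsilon>) auto
  moreover have "\<dots> = - \<epsilon> * (\<Sum>j\<in>UNIV. real (y j))" by (simp add: sum_distrib_left)
  ultimately show ?thesis by linarith
qed

lemma finite_states_bounded_total:
  assumes "0 < \<epsilon>"
  shows "finite {y :: 'n \<Rightarrow> nat. \<epsilon> * (\<Sum>j\<in>UNIV. real (y j)) \<le> b}"
proof (rule finite_subset)
  show "{y :: 'n \<Rightarrow> nat. \<epsilon> * (\<Sum>j\<in>UNIV. real (y j)) \<le> b} \<subseteq> (\<Pi>\<^sub>E j\<in>UNIV. {..nat \<lfloor>b / \<epsilon>\<rfloor>})"
  proof
    fix y :: "'n \<Rightarrow> nat" assume "y \<in> {y. \<epsilon> * (\<Sum>j\<in>UNIV. real (y j)) \<le> b}"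
    then have b: "(\<Sum>j\<in>UNIV. real (y j)) \<le> b / \<epsilon>" using assms by (simp add: field_simps)
    have "real (y j) \<le> b / \<epsilon>" for j
      by (rule order.trans[OF member_le_sum b]) auto
    then have "y j \<le> nat \<lfloor>b / \<epsilon>\<rfloor>" for j by (simp add: le_nat_floor)
    then show "y \<in> (\<Pi>\<^sub>E j\<in>UNIV. {..nat \<lfloor>b / \<epsilon>\<rfloor>})" by auto
  qed
qed (intro finite_PiE; simp)

text \<open>Foster's criterion for the quadratic function \<open>\<Sum>j. w j * (y j)\<^sup>2\<close>, with the same weights \<open>w\<close> that
  define the JLW policy.\<close>

lemma static_stable_imp_jlw_stable:
  assumes w: "\<And>j. 0 < w j" and p: "p \<in> static_policies I S lam"
    and neg: "\<And>j. drift I lam mu p j < 0"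
  shows "excursion_mean (rate (jlw S w)) x < \<top>"
proof -
  let ?q = "rate (jlw S w)" and ?a = "arr (jlw S w)"
  interpret conservative_rates ?q by (rule conservative_rates_queue[OF jlw_policy])
  \<comment> \<open>The slowest decrease per customer.\<close>
  define \<epsilon> where "\<epsilon> = Min (range (\<lambda>j. - (2 * (w j * drift I lam mu p j))))"
  define B where "B = (\<Sum>j\<in>UNIV. w j * (sum lam (active I lam) + mu j))"
  have \<epsilon>: "0 < \<epsilon>"
    unfolding \<epsilon>_def using w neg by (subst Min_gr_iff) (auto simp: mult_pos_neg)
  have \<epsilon>_le: "2 * (w j * drift I lam mu p j) \<le> - \<epsilon>" for j
  proof -
    have "\<epsilon> \<le> - (2 * (w j * drift I lam mu p j))" unfolding \<epsilon>_def by (intro Min_le) auto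
    then show ?thesis by linarith
  qed
  have B: "0 \<le> B" unfolding B_def
    by (intro sum_nonneg mult_nonneg_nonneg add_nonneg_nonneg less_imp_le[OF w]
        less_imp_le[OF mu_pos] less_imp_le[OF total_arrivals_pos])
  define f where "f y = (\<Sum>j\<in>UNIV. w j * (real (y j))\<^sup>2)" for y :: "'n \<Rightarrow> nat"
  have f: "0 \<le> f y" for y unfolding f_def using w by (intro sum_nonneg) (auto simp: less_imp_le)
  \<comment> \<open>Outside \<open>F\<close> the drift bound \<open>B - \<epsilon> * (\<Sum>j. y j)\<close> is below \<open>- 1\<close>; inside it is at most \<open>B = - 1 + (B + 1)\<close>.\<close>
  define F where "F = {y :: 'n \<Rightarrow> nat. \<epsilon> * (\<Sum>j\<in>UNIV. real (y j)) \<le> B + 1}"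
  have up: "f (y(j := y j + 1)) = f y + w j * (2 * real (y j) + 1)" for y j
    unfolding f_def sum_fun_upd[where g = "\<lambda>l v. w l * (real v)\<^sup>2"]
    by (simp add: power2_eq_square algebra_simps)
  have down: "f (y(j := y j - 1)) = f y + w j * (1 - 2 * real (y j))" if "1 \<le> y j" for y j
    unfolding f_def sum_fun_upd[where g = "\<lambda>l v. w l * (real v)\<^sup>2"]
    using that by (simp add: of_nat_diff power2_eq_square algebra_simps)
  have drift: "(\<Sum>j\<in>UNIV. ?a y j * f (y(j := y j + 1))) +
      (\<Sum>j\<in>{j. 1 \<le> y j}. mu j * f (y(j := y j - 1))) + 1
      \<le> exit_rate ?q y * f y + (B + 1) * indicator F y" for y
  proof -
    have "(\<Sum>j\<in>UNIV. ?a y j * f (y(j := y j + 1)))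
        = (\<Sum>j\<in>UNIV. ?a y j) * f y + (\<Sum>j\<in>UNIV. ?a y j * (w j * (2 * real (y j) + 1)))"
      unfolding up distrib_left[of "?a y _"] sum.distrib sum_distrib_right ..
    moreover have "(\<Sum>j\<in>{j. 1 \<le> y j}. mu j * f (y(j := y j - 1)))
        = (\<Sum>j\<in>{j. 1 \<le> y j}. mu j) * f y +
          (\<Sum>j\<in>{j. 1 \<le> y j}. mu j * (w j * (1 - 2 * real (y j))))"
      unfolding sum_distrib_right sum.distrib[symmetric] distrib_left[symmetric]
      by (intro sum.cong refl) (simp only: down mem_Collect_eq)
    moreover have "(\<Sum>j\<in>UNIV. ?a y j * (w j * (2 * real (y j) + 1))) +
        (\<Sum>j\<in>{j. 1 \<le> y j}. mu j * (w j * (1 - 2 * real (y j))))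
        \<le> B - \<epsilon> * (\<Sum>j\<in>UNIV. real (y j))"
      unfolding B_def by (intro jlw_quadratic_drift[OF w p \<epsilon>_le])
    moreover have "B - \<epsilon> * (\<Sum>j\<in>UNIV. real (y j)) + 1 \<le> (B + 1) * indicator F y"
      using \<epsilon> by (auto simp: F_def indicator_def sum_nonneg)
    ultimately show ?thesis unfolding exit_rate_eq distrib_right by linarith
  qed
  show ?thesis
  proof (rule foster[where f = "\<lambda>y. ennreal (f y)" and F = F and c = "ennreal (B + 1)"])
    fix y
    note a = arrival_rate_nonneg[OF jlw_policy, of w]
    have "(\<integral>\<^sup>+z. ennreal (?q y z) * ennreal (f z) \<partial>count_space UNIV) =
      (\<Sum>j\<in>UNIV. ennreal (?a y j * f (y(j := y j + 1)))) +
      (\<Sum>j\<in>{j. 1 \<le> y j}. ennreal (mu j * f (y(j := y j - 1))))"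
      unfolding nn_integral_queue_rate[OF jlw_policy]
      by (simp only: ennreal_mult f a less_imp_le[OF mu_pos])
    also have "\<dots> = ennreal (\<Sum>j\<in>UNIV. ?a y j * f (y(j := y j + 1))) +
      ennreal (\<Sum>j\<in>{j. 1 \<le> y j}. mu j * f (y(j := y j - 1)))"
      by (intro arg_cong2[where f = "(+)"] sum_ennreal mult_nonneg_nonneg f a less_imp_le[OF mu_pos])
    finally have "(\<integral>\<^sup>+z. ennreal (?q y z) * ennreal (f z) \<partial>count_space UNIV) + 1
      = ennreal (\<Sum>j\<in>UNIV. ?a y j * f (y(j := y j + 1))) +
        ennreal (\<Sum>j\<in>{j. 1 \<le> y j}. mu j * f (y(j := y j - 1))) + 1"
      by (rule arg_cong)
    also have "\<dots> = ennreal ((\<Sum>j\<in>UNIV. ?a y j * f (y(j := y j + 1))) +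
      (\<Sum>j\<in>{j. 1 \<le> y j}. mu j * f (y(j := y j - 1))) + 1)"
    proof -
      have "0 \<le> (\<Sum>j\<in>UNIV. ?a y j * f (y(j := y j + 1)))"
        "0 \<le> (\<Sum>j\<in>{j. 1 \<le> y j}. mu j * f (y(j := y j - 1)))"
        by (intro sum_nonneg mult_nonneg_nonneg f a less_imp_le[OF mu_pos])+
      then show ?thesis by (simp only: ennreal_plus add_nonneg_nonneg zero_le_one ennreal_1)
    qed
    also have "\<dots> \<le> ennreal (exit_rate ?q y * f y + (B + 1) * indicator F y)"
      by (rule ennreal_leI[OF drift])
    also have "\<dots> = ennreal (exit_rate ?q y) * ennreal (f y) + ennreal (B + 1) * indicator F y"
    proof -
      have nonneg: "0 \<le> exit_rate ?q y" "0 \<le> B + 1" "0 \<le> (indicator F y :: real)"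
        using exit_pos[of y] B by (simp_all only: less_imp_le add_nonneg_nonneg zero_le_one indicator_pos_le)
      then show ?thesis
        by (simp only: ennreal_plus ennreal_mult mult_nonneg_nonneg f ennreal_indicator)
    qed
    finally show "(\<integral>\<^sup>+z. ennreal (?q y z) * ennreal (f z) \<partial>count_space UNIV) + 1
      \<le> ennreal (exit_rate ?q y) * ennreal (f y) + ennreal (B + 1) * indicator F y" .
  next
    show "finite F" unfolding F_def by (rule finite_states_bounded_total[OF \<epsilon>])
  next
    show "(y, x) \<in> {(y, z). 0 < ?q y z}\<^sup>*" for y by (rule jlw_irreducible) (rule w)
  qed auto
qed

section \<open>From a stable policy to a stable static policy\<close>

text \<open>The queue length at \<open>j\<close>, truncated at \<open>m\<close> to make it bounded, gains arrivals while it is below \<open>m\<close>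
  and loses services while it is positive and at most \<open>m\<close>. The losses stand on the left-hand side,
  where they add to the positive part of the generator.\<close>

lemma truncated_queue_generator:
  assumes "policy \<pi>"
  shows "(\<integral>\<^sup>+z. ennreal (rate \<pi> y z) * ennreal (min (z j) m) \<partial>count_space UNIV) +
      ennreal (mu j) * (if 1 \<le> y j \<and> y j \<le> m then 1 else 0)
    = ennreal (exit_rate (rate \<pi>) y) * ennreal (min (y j) m) +
      ennreal (arr \<pi> y j) * (if y j < m then 1 else 0)"
proof -
  let ?a = "arr \<pi> y" and ?D = "{l. 1 \<le> y l}"
  note nonneg = arrival_rate_nonneg[OF assms] less_imp_le[OF mu_pos]
  define U where "U = (\<Sum>l\<in>UNIV. ?a l * real (min ((y(l := y l + 1)) j) m))"
  define D where "D = (\<Sum>l\<in>?D. mu l * real (min ((y(l := y l - 1)) j) m))"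
  define u where "u = ?a j * (if y j < m then 1 else 0)"
  define d where "d = mu j * (if 1 \<le> y j \<and> y j \<le> m then 1 else 0)"
  define r where "r = real (min (y j) m)"
  define e where "e = exit_rate (rate \<pi>) y"
  have pos: "0 \<le> U" "0 \<le> D" "0 \<le> u" "0 \<le> d" "0 \<le> r" "0 \<le> e"
    unfolding U_def D_def u_def d_def r_def e_def exit_rate_eq
    by (auto intro!: sum_nonneg mult_nonneg_nonneg add_nonneg_nonneg simp: nonneg)
  have up: "U = (\<Sum>l\<in>UNIV. ?a l) * r + u"
  proof -
    have "U = (\<Sum>l\<in>UNIV. ?a l * r + (if l = j then u else 0))"
      unfolding U_def by (intro sum.cong) (auto simp: u_def r_def min_def algebra_simps)
    then show ?thesis by (simp add: sum.distrib sum_distrib_right)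
  qed
  have down: "D + d = (\<Sum>l\<in>?D. mu l) * r"
  proof -
    have "(\<Sum>l\<in>?D. mu l) * r =
        (\<Sum>l\<in>?D. mu l * real (min ((y(l := y l - 1)) j) m) + (if l = j then d else 0))"
      unfolding sum_distrib_right
      by (intro sum.cong) (auto simp: d_def r_def min_def algebra_simps of_nat_diff)
    then show ?thesis by (simp add: sum.distrib D_def d_def)
  qed
  have "(\<integral>\<^sup>+z. ennreal (rate \<pi> y z) * ennreal (min (z j) m) \<partial>count_space UNIV) =
      (\<Sum>l\<in>UNIV. ennreal (?a l * real (min ((y(l := y l + 1)) j) m))) +
      (\<Sum>l\<in>?D. ennreal (mu l * real (min ((y(l := y l - 1)) j) m)))"
    unfolding nn_integral_queue_rate[OF assms]
    by (intro arg_cong2[where f = "(+)"] sum.cong refl ennreal_mult[symmetric])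
      (simp_all only: nonneg of_nat_0_le_iff)
  also have "\<dots> = ennreal U + ennreal D" unfolding U_def D_def
    by (intro arg_cong2[where f = "(+)"] sum_ennreal mult_nonneg_nonneg nonneg of_nat_0_le_iff)
  finally have "(\<integral>\<^sup>+z. ennreal (rate \<pi> y z) * ennreal (min (z j) m) \<partial>count_space UNIV) + ennreal d
      = ennreal U + ennreal D + ennreal d"
    by (rule arg_cong)
  also have "\<dots> = ennreal (U + (D + d))"
    using pos by (simp add: ennreal_plus[symmetric] add.assoc del: ennreal_plus)
  also have "U + (D + d) = e * r + u"
    unfolding up down by (simp add: e_def exit_rate_eq algebra_simps)
  also have "ennreal \<dots> = ennreal e * ennreal r + ennreal u"
    using pos by (simp add: ennreal_plus ennreal_mult)
  finally have "(\<integral>\<^sup>+z. ennreal (rate \<pi> y z) * ennreal (min (z j) m) \<partial>count_space UNIV) + ennreal d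
      = ennreal e * ennreal r + ennreal u" .
  moreover have "ennreal d = ennreal (mu j) * (if 1 \<le> y j \<and> y j \<le> m then 1 else 0)"
    "ennreal u = ennreal (?a j) * (if y j < m then 1 else 0)"
    by (simp_all add: d_def u_def)
  ultimately show ?thesis by (simp only: e_def r_def)
qed

text \<open>In equilibrium the arrivals at station \<open>j\<close> cannot exceed its services. This follows by testing
  the occupation measure of excursions from the empty state with the truncated queue length and letting
  the truncation level grow. The truncation is what permits cancelling: the untruncated queue length may
  have infinite mean.\<close>

lemma occupation_flow:
  assumes pol: "policy \<pi>" and fin: "excursion_mean (rate \<pi>) (\<lambda>_. 0) < \<top>"
  defines "\<nu> \<equiv> conservative_rates.occupation (rate \<pi>) (\<lambda>_. 0)"
  shows "(\<integral>\<^sup>+y. \<nu> y * ennreal (arr \<pi> y j) \<partial>count_space UNIV)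
    \<le> ennreal (mu j) * (\<integral>\<^sup>+y. \<nu> y * (if 1 \<le> y j then 1 else 0) \<partial>count_space UNIV)"
proof -
  interpret conservative_rates "rate \<pi>" by (rule conservative_rates_queue[OF pol])
  have Z: "(\<integral>\<^sup>+y. \<nu> y \<partial>count_space UNIV) < \<top>"
    unfolding \<nu>_def nn_integral_occupation by (rule fin)
  have trunc: "(\<integral>\<^sup>+y. \<nu> y * (ennreal (arr \<pi> y j) * (if y j < m then 1 else 0)) \<partial>count_space UNIV)
      = (\<integral>\<^sup>+y. \<nu> y * (ennreal (mu j) * (if 1 \<le> y j \<and> y j \<le> m then 1 else 0)) \<partial>count_space UNIV)"
    (is "?in = ?out") for m
  proof -
    define K where "K = (\<integral>\<^sup>+y. \<nu> y * (ennreal (exit_rate (rate \<pi>) y) * ennreal (min (y j) m)) \<partial>count_space UNIV)"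
    have "K \<le> (\<integral>\<^sup>+y. \<nu> y * ennreal ((sum lam (active I lam) + (\<Sum>j\<in>UNIV. mu j)) * real m)
        \<partial>count_space UNIV)"
      unfolding K_def
    proof (intro nn_integral_mono mult_left_mono)
      fix y
      have "exit_rate (rate \<pi>) y * real (min (y j) m)
          \<le> (sum lam (active I lam) + (\<Sum>j\<in>UNIV. mu j)) * real m"
        by (rule mult_mono'[OF exit_rate_le[OF pol]]) (simp_all add: less_imp_le[OF exit_pos])
      then show "ennreal (exit_rate (rate \<pi>) y) * ennreal (min (y j) m)
          \<le> ennreal ((sum lam (active I lam) + (\<Sum>j\<in>UNIV. mu j)) * real m)"
        by (simp only: ennreal_mult[symmetric] less_imp_le[OF exit_pos] of_nat_0_le_iff ennreal_leI)
    qed simp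
    also have "\<dots> < \<top>" using Z by (simp add: nn_integral_multc ennreal_mult_less_top)
    finally have K: "K < \<top>" .
    have "K + ?out = (\<integral>\<^sup>+y. \<nu> y * ((\<integral>\<^sup>+z. ennreal (rate \<pi> y z) * ennreal (min (z j) m) \<partial>count_space UNIV) +
      ennreal (mu j) * (if 1 \<le> y j \<and> y j \<le> m then 1 else 0)) \<partial>count_space UNIV)"
      unfolding K_def \<nu>_def using occupation_balance[of "\<lambda>z. ennreal (min (z j) m)" "\<lambda>_. 0"]
      by (simp add: distrib_left nn_integral_add)
    also have "\<dots> = K + ?in"
      unfolding truncated_queue_generator[OF pol] K_def by (simp add: distrib_left nn_integral_add)
    finally show ?thesis using K by (auto simp: ennreal_add_left_cancel)
  qed
  have "(\<integral>\<^sup>+y. \<nu> y * ennreal (arr \<pi> y j) \<partial>count_space UNIV) =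
      (\<integral>\<^sup>+y. (SUP m. \<nu> y * (ennreal (arr \<pi> y j) * (if y j < m then 1 else 0))) \<partial>count_space UNIV)"
  proof (rule nn_integral_cong)
    fix y
    show "\<nu> y * ennreal (arr \<pi> y j)
      = (SUP m. \<nu> y * (ennreal (arr \<pi> y j) * (if y j < m then 1 else 0)))"
    proof (rule antisym)
      show "\<nu> y * ennreal (arr \<pi> y j)
          \<le> (SUP m. \<nu> y * (ennreal (arr \<pi> y j) * (if y j < m then 1 else 0)))"
        by (rule SUP_upper2[of "Suc (y j)"]) simp_all
    qed (auto intro!: SUP_least)
  qed
  also have "\<dots> = (SUP m. \<integral>\<^sup>+y. \<nu> y * (ennreal (arr \<pi> y j) * (if y j < m then 1 else 0)) \<partial>count_space UNIV)"
    by (rule nn_integral_monotone_convergence_SUP)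
      (auto simp: incseq_def le_fun_def intro!: mult_left_mono)
  also have "\<dots> \<le> (\<integral>\<^sup>+y. ennreal (mu j) * (\<nu> y * (if 1 \<le> y j then 1 else 0)) \<partial>count_space UNIV)"
    unfolding trunc by (intro SUP_least nn_integral_mono) (auto simp: mult_ac)
  also have "\<dots> = ennreal (mu j) * (\<integral>\<^sup>+y. \<nu> y * (if 1 \<le> y j then 1 else 0) \<partial>count_space UNIV)"
    by (rule nn_integral_cmult) simp
  finally show ?thesis .
qed

text \<open>Averaging the routing probabilities of a stable policy over its equilibrium gives a static policy.
  Its arrivals at station \<open>j\<close> are the equilibrium arrivals, hence at most \<open>mu j\<close> times the fraction of
  time in which \<open>j\<close> is busy. That fraction is less than one, because the empty state has positive weight.\<close>

lemma stable_imp_static_stable: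
  assumes pol: "policy \<pi>" and fin: "excursion_mean (rate \<pi>) (\<lambda>_. 0) < \<top>"
  shows "\<exists>p\<in>static_policies I S lam. \<forall>j. drift I lam mu p j < 0"
proof -
  interpret conservative_rates "rate \<pi>" by (rule conservative_rates_queue[OF pol])
  define \<nu> where "\<nu> = occupation (\<lambda>_. 0)"
  define Z where "Z = (\<integral>\<^sup>+y. \<nu> y \<partial>count_space UNIV)"
  define A where "A i j = (\<integral>\<^sup>+y. \<nu> y * ennreal (\<pi> (\<lambda>k. int (y k)) i j) \<partial>count_space UNIV)" for i j
  have Z: "Z < \<top>" unfolding Z_def \<nu>_def nn_integral_occupation by (rule fin)
  have "0 < \<nu> (\<lambda>_. 0)" unfolding \<nu>_def by (rule occupation_start_pos)
  also have start: "\<nu> (\<lambda>_. 0) \<le> Z" unfolding Z_def by (rule nn_integral_ge_point) simp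
  finally have Z_pos: "0 < Z" .
  define z where "z = enn2real Z"
  have z: "0 < z" "ennreal z = Z" using Z Z_pos by (auto simp: z_def enn2real_positive_iff)
  have A_le: "A i j < \<top>" if "i \<in> active I lam" for i j
  proof -
    have "A i j \<le> Z" unfolding A_def Z_def
      using policyD(4)[OF pol that] by (intro nn_integral_mono mult_left_le) auto
    then show ?thesis using Z by order
  qed
  define p where "p i j = enn2real (A i j) / z" for i j
  have "p \<in> static_policies I S lam"
    unfolding static_policies_def is_policy_def mem_Collect_eq
  proof (intro allI ballI conjI impI)
    fix i assume i: "i \<in> active I lam"
    note D = policyD[OF pol i]
    show "0 \<le> p i j" for j using z by (simp add: p_def)
    show "p i j = 0" if "j \<notin> S i" for j using D(3)[OF that] by (simp add: p_def A_def)
    have "(\<Sum>j\<in>UNIV. A i j)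
        = (\<integral>\<^sup>+y. (\<Sum>j\<in>UNIV. \<nu> y * ennreal (\<pi> (\<lambda>k. int (y k)) i j)) \<partial>count_space UNIV)"
      unfolding A_def by (rule nn_integral_sum[symmetric]) simp
    also have "\<dots> = Z" unfolding Z_def
      by (intro nn_integral_cong) (simp add: sum_distrib_left[symmetric] D)
    finally have "(\<Sum>j\<in>UNIV. A i j) = Z" .
    moreover have "ennreal (\<Sum>j\<in>UNIV. enn2real (A i j)) = (\<Sum>j\<in>UNIV. A i j)"
      using A_le[OF i] by (simp add: sum_ennreal[symmetric])
    ultimately have "ennreal (\<Sum>j\<in>UNIV. enn2real (A i j)) = ennreal z" using z by simp
    then have "(\<Sum>j\<in>UNIV. enn2real (A i j)) = z" using z(1)
      by (subst (asm) ennreal_inj) (simp_all add: sum_nonneg)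
    then show "(\<Sum>j\<in>UNIV. p i j) = 1"
      using z by (simp add: p_def sum_divide_distrib[symmetric])
  qed
  moreover have "drift I lam mu p j < 0" for j
  proof -
    have "ennreal (\<Sum>i\<in>active I lam. lam i * enn2real (A i j)) = (\<Sum>i\<in>active I lam. ennreal (lam i) * A i j)"
      using A_le by (subst sum_ennreal[symmetric]) (auto simp: ennreal_mult lam_pos less_imp_le intro!: sum.cong)
    also have "\<dots> = (\<integral>\<^sup>+y. (\<Sum>i\<in>active I lam. ennreal (lam i) * (\<nu> y * ennreal (\<pi> (\<lambda>k. int (y k)) i j))) \<partial>count_space UNIV)"
      by (simp add: nn_integral_sum nn_integral_cmult A_def)
    also have "\<dots> = (\<integral>\<^sup>+y. \<nu> y * ennreal (arr \<pi> y j) \<partial>count_space UNIV)"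
    proof (rule nn_integral_cong)
      fix y
      have "ennreal (arr \<pi> y j) = (\<Sum>i\<in>active I lam. ennreal (lam i) * ennreal (\<pi> (\<lambda>k. int (y k)) i j))"
        unfolding arrival_rate_eq[OF pol] using policyD(1)[OF pol]
        by (subst sum_ennreal[symmetric]) (auto simp: ennreal_mult lam_pos less_imp_le intro!: sum.cong)
      then show "(\<Sum>i\<in>active I lam. ennreal (lam i) * (\<nu> y * ennreal (\<pi> (\<lambda>k. int (y k)) i j)))
        = \<nu> y * ennreal (arr \<pi> y j)" by (simp add: sum_distrib_left mult_ac)
    qed
    also have "\<dots> \<le> ennreal (mu j) * (\<integral>\<^sup>+y. \<nu> y * (if 1 \<le> y j then 1 else 0) \<partial>count_space UNIV)"
      unfolding \<nu>_def by (rule occupation_flow[OF pol fin])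
    also have "\<dots> < ennreal (mu j) * Z"
    proof -
      let ?busy = "\<integral>\<^sup>+y. \<nu> y * (if 1 \<le> y j then 1 else 0) \<partial>count_space UNIV"
      have "?busy + \<nu> (\<lambda>_. 0) = (\<integral>\<^sup>+y. \<nu> y * (if 1 \<le> y j then 1 else 0) + \<nu> y * indicator {\<lambda>_. 0} y \<partial>count_space UNIV)"
        by (simp add: nn_integral_add)
      also have "\<dots> \<le> Z" unfolding Z_def by (intro nn_integral_mono) (auto simp: indicator_def)
      finally have le: "?busy + \<nu> (\<lambda>_. 0) \<le> Z" .
      have "?busy \<le> Z" by (rule order.trans[OF _ le]) simp
      then have "?busy < \<top>" using Z by (rule le_less_trans)
      moreover have "0 < \<nu> (\<lambda>_. 0)" by fact
      ultimately have "?busy + 0 < ?busy + \<nu> (\<lambda>_. 0)"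
        by (simp add: ennreal_add_left_cancel_less del: add_0_right)
      from less_le_trans[OF this le] have "?busy < Z" by (simp only: add_0_right)
      then show ?thesis using mu_pos[of j] by (intro ennreal_mult_strict_left_mono) auto
    qed
    also have "\<dots> = ennreal (mu j * z)" using z mu_pos[of j] by (simp add: ennreal_mult less_imp_le)
    finally have "(\<Sum>i\<in>active I lam. lam i * enn2real (A i j)) < mu j * z"
      by (simp add: ennreal_less_iff sum_nonneg lam_pos less_imp_le)
    then have "(\<Sum>i\<in>active I lam. lam i * enn2real (A i j)) / z < mu j"
      using z by (simp add: field_simps)
    then show ?thesis by (simp add: drift_def p_def sum_divide_distrib)
  qed
  ultimately show ?thesis by blast
qed

end

section \<open>Independence of the weights\<close>

text \<open>Positive weights do not change the signs of the drifts.\<close>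

lemma V1_neg_iff:
  fixes S :: "'i \<Rightarrow> 'n::finite set"
  assumes "\<And>i. i \<in> I \<Longrightarrow> S i \<noteq> {}" and w: "\<And>j. 0 < w j"
  shows "V1 I S lam mu w < 0 \<longleftrightarrow> (\<exists>p\<in>static_policies I S lam. \<forall>j. drift I lam mu p j < 0)"
proof -
  have neg: "max_drift I lam mu w p < 0 \<longleftrightarrow> (\<forall>j. drift I lam mu p j < 0)" for p
    unfolding max_drift_def by (subst Max_less_iff) (auto simp: mult_less_0_iff w less_not_sym[OF w])
  have "\<exists>p\<in>static_policies I S lam. V1 I S lam mu w = max_drift I lam mu w p \<and>
      (\<forall>p'\<in>static_policies I S lam. max_drift I lam mu w p \<le> max_drift I lam mu w p')"
    by (rule V1_attained) (rule assms(1))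
  then obtain p where p: "p \<in> static_policies I S lam" "V1 I S lam mu w = max_drift I lam mu w p"
    "\<And>p'. p' \<in> static_policies I S lam \<Longrightarrow> max_drift I lam mu w p \<le> max_drift I lam mu w p'"
    by auto
  have "V1 I S lam mu w < 0" if "p' \<in> static_policies I S lam" "\<forall>j. drift I lam mu p' j < 0" for p'
    using p(3)[OF that(1)] that(2) neg[of p'] p(2) by simp
  then show ?thesis using p(1,2) neg[of p] by auto
qed

theorem theorem3:
  fixes I :: "'i set" and S :: "'i \<Rightarrow> 'n::finite set"
    and lam :: "'i \<Rightarrow> real" and mu :: "'n \<Rightarrow> real"
    and P :: "('n \<Rightarrow> nat) \<Rightarrow> 'a measure" and X :: "real \<Rightarrow> 'a \<Rightarrow> 'n \<Rightarrow> nat"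
    and P' :: "('n \<Rightarrow> nat) \<Rightarrow> 'b measure" and X' :: "real \<Rightarrow> 'b \<Rightarrow> 'n \<Rightarrow> nat"
  assumes "finite I"
    and "\<And>i. i \<in> I \<Longrightarrow> S i \<noteq> {}"
    and "\<And>i. i \<in> I \<Longrightarrow> 0 \<le> lam i"
    and "\<And>j. 0 < mu j"
    and "network_connected I S lam"
  shows "((\<exists>w. (\<forall>j. 0 < w j) \<and> V1 I S lam mu w < 0) \<longrightarrow>
            (\<forall>w'. (\<forall>j. 0 < w' j) \<longrightarrow> V1 I S lam mu w' < 0)) \<and>
         ((\<exists>w. (\<forall>j. 0 < w j) \<and>
               markov_chain (queue_rate I S lam mu (jlw S w)) P X \<and>
               positive_recurrent (queue_rate I S lam mu (jlw S w)) P X) \<longrightarrow>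
            (\<forall>w'. (\<forall>j. 0 < w' j) \<longrightarrow>
               markov_chain (queue_rate I S lam mu (jlw S w')) P' X' \<longrightarrow>
               positive_recurrent (queue_rate I S lam mu (jlw S w')) P' X'))"
proof (intro conjI impI allI)
  fix w' :: "'n \<Rightarrow> real"
  assume "\<exists>w. (\<forall>j. 0 < w j) \<and> V1 I S lam mu w < 0" "\<forall>j. 0 < w' j"
  then show "V1 I S lam mu w' < 0" by (auto simp: V1_neg_iff[OF assms(2)])
next
  fix w' :: "'n \<Rightarrow> real"
  assume "\<exists>w. (\<forall>j. 0 < w j) \<and>
      markov_chain (queue_rate I S lam mu (jlw S w)) P X \<and>
      positive_recurrent (queue_rate I S lam mu (jlw S w)) P X"
    and w': "\<forall>j. 0 < w' j"
    and mc': "markov_chain (queue_rate I S lam mu (jlw S w')) P' X'"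
  then obtain w where mc: "markov_chain (queue_rate I S lam mu (jlw S w)) P X"
    and rec: "positive_recurrent (queue_rate I S lam mu (jlw S w)) P X" by blast
  show "positive_recurrent (queue_rate I S lam mu (jlw S w')) P' X'"
  proof (cases "active I lam = {}")
    case True
    \<comment> \<open>Without arrivals the policy does not affect the rates, and only the realisation changes.\<close>
    have eq: "queue_rate I S lam mu (jlw S w) = queue_rate I S lam mu (jlw S w')"
      using True by (intro ext) (simp add: queue_rate_def arrival_rate_def)
    have "0 \<le> queue_rate I S lam mu (jlw S w) y z" for y z
      unfolding queue_rate_def arrival_rate_def using True assms(4)
      by (auto intro!: sum_nonneg simp: less_imp_le)
    then show ?thesis
      using rec positive_recurrent_iff[OF mc] positive_recurrent_iff[OF mc'] unfolding eq by blast
  next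
    case False
    interpret network I S lam mu using assms False by unfold_locales auto
    have "exit_rate (rate (jlw S w)) (\<lambda>_. 0) \<noteq> 0"
      using conservative_rates.exit_pos[OF conservative_rates_queue[OF jlw_policy]] by (metis less_irrefl)
    then have "excursion_mean (rate (jlw S w)) (\<lambda>_. 0) < \<top>"
      using rec unfolding positive_recurrent_iff[OF mc queue_rate_nonneg[OF jlw_policy]] by blast
    from stable_imp_static_stable[OF jlw_policy this] obtain p where
      p: "p \<in> static_policies I S lam" "\<And>j. drift I lam mu p j < 0" by blast
    have "excursion_mean (rate (jlw S w')) x < \<top>" for x
      using w' by (intro static_stable_imp_jlw_stable[OF _ p]) blast
    then show ?thesis
      unfolding positive_recurrent_iff[OF mc' queue_rate_nonneg[OF jlw_policy]] by blast
  qed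
qed

end
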